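(* Let $\lambda$ be a frequency and $1\le p\le\infty$. The Hardy space $\mathcal{H}_p(\lambda)$ is independent of the chosen $\lambda$-Dirichlet group $(G,\beta)$. That is, if $(G,\beta_G)$ and $(H,\beta_H)$ are two $\lambda$-Dirichlet groups, then the spaces of $\lambda$-Dirichlet series $\mathcal{H}_p(\lambda)$ defined by means of $(G,\beta_G)$ and by means of $(H,\beta_H)$ coincide, with equal norms.
   Context: A frequency is a strictly increasing sequence $\lambda=(\lambda_n)_{n\ge1}$ of non-negative real numbers tending to $\infty$. A $\lambda$-Dirichlet series is a formal sum $D=\sum a_n e^{-\lambda_n s}$ with complex coefficients $a_n$ and complex variable $s$. A Dirichlet group is a pair $(G,\beta)$ of a compact abelian group $G$ and a continuous homomorphism $\beta\colon\mathbb{R}\to G$ with dense range. It is a $\lambda$-Dirichlet group if for every $n$ there is a (necessarily unique) character $h_{\lambda_n}=h_{\lambda_n}^{(G,\beta)}\in\widehat{G}$ with $h_{\lambda_n}(\beta(t))=e^{-i\lambda_n t}$ for all $t\in\mathbb{R}$. $L_p(G)$ is taken with respect to the normalized Haar measure $m$, and $\widehat{f}(\gamma)=\int_G f\overline{\gamma}\,dm$ for $\gamma\in\widehat G$. $H_p^\lambda(G)$ is the Banach space of all $f\in L_p(G)$ such that $\widehat f(\gamma)\ne0$ only if $\gamma=h_{\lambda_n}$ for some $n$. Given a $\lambda$-Dirichlet group $(G,\beta)$, the Hardy space $\mathcal{H}_p(\lambda)$ defined by means of $(G,\beta)$ is the space of all $\lambda$-Dirichlet series $D=\sum a_ne^{-\lambda_ns}$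 for which there is $f\in H_p^\lambda(G)$ with $\widehat f(h_{\lambda_n})=a_n$ for all $n$, with norm $\|D\|_p:=\|f\|_p$. *)

theory Defs
  imports "HOL-Analysis.Analysis" "HOL-Probability.Essential_Supremum"
begin

(* Index n stands for the (n+1)-st frequency lambda_{n+1}. *)
definition frequency :: "(nat \<Rightarrow> real) \<Rightarrow> bool" where
  "frequency l \<longleftrightarrow> strict_mono l \<and> (\<forall>n. 0 \<le> l n) \<and> filterlim l at_top sequentially"

(* Compact abelian groups are written additively and are Hausdorff by the sort constraint
   on the carrier type. *)
definition dirichlet_group ::
    "(real \<Rightarrow> 'g::{topological_ab_group_add, t2_space}) \<Rightarrow> bool" where
  "dirichlet_group \<beta> \<longleftrightarrow>
     compact (UNIV :: 'g set) \<and>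
     continuous_on UNIV \<beta> \<and> (\<forall>s t. \<beta> (s + t) = \<beta> s + \<beta> t) \<and>
     closure (range \<beta>) = UNIV"

definition characters :: "('g::topological_ab_group_add \<Rightarrow> complex) set" where
  "characters = {\<gamma>. continuous_on UNIV \<gamma> \<and> (\<forall>x. cmod (\<gamma> x) = 1) \<and>
                    (\<forall>x y. \<gamma> (x + y) = \<gamma> x * \<gamma> y)}"

definition lambda_dirichlet_group ::
    "(nat \<Rightarrow> real) \<Rightarrow> (real \<Rightarrow> 'g::{topological_ab_group_add, t2_space}) \<Rightarrow> bool" where
  "lambda_dirichlet_group l \<beta> \<longleftrightarrow>
     dirichlet_group \<beta> \<and>
     (\<forall>n. \<exists>h \<in> characters. \<forall>t. h (\<beta> t) = exp (- \<i> * complex_of_real (l n * t)))"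

definition char_at ::
    "(real \<Rightarrow> 'g::{topological_ab_group_add, t2_space}) \<Rightarrow> real \<Rightarrow> 'g \<Rightarrow> complex" where
  "char_at \<beta> x =
     (THE h. h \<in> characters \<and> (\<forall>t. h (\<beta> t) = exp (- \<i> * complex_of_real (x * t))))"

lemma char_at_eqI:
  assumes "dirichlet_group \<beta>" "h \<in> characters"
    and "\<And>t. h (\<beta> t) = exp (- \<i> * complex_of_real (x * t))"
  shows "char_at \<beta> x = h"
  unfolding char_at_def
proof (rule the_equality)
  fix k assume k: "k \<in> characters \<and> (\<forall>t. k (\<beta> t) = exp (- \<i> * complex_of_real (x * t)))"
  have "closed {y. k y = h y}"
    using k assms(2) by (intro closed_Collect_eq) (auto simp: characters_def)
  moreover have "range \<beta> \<subseteq> {y. k y = h y}"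
    using k assms(3) by auto
  ultimately have "closure (range \<beta>) \<subseteq> {y. k y = h y}"
    by (rule closure_minimal[rotated])
  then show "k = h"
    using assms(1) by (auto simp: dirichlet_group_def)
qed (use assms in auto)

(* Regularity is part of the definition: a dense image of the real line does not make a
   compact group metrizable, so it is not automatic for Borel measures. *)
definition normalized_haar :: "'g::{topological_ab_group_add, t2_space} measure \<Rightarrow> bool" where
  "normalized_haar m \<longleftrightarrow>
     sets m = sets borel \<and> emeasure m UNIV = 1 \<and>
     (\<forall>x. distr m borel (\<lambda>y. x + y) = m) \<and>
     (\<forall>A \<in> sets borel. emeasure m A = (SUP K \<in> {K. compact K \<and> K \<subseteq> A}. emeasure m K)) \<and>
     (\<forall>A \<in> sets borel. emeasure m A = (INF U \<in> {U. open U \<and> A \<subseteq> U}. emeasure m U))"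

(* Elements of Lp are represented by Borel functions rather than almost-everywhere classes. *)
definition Lp_norm :: "ennreal \<Rightarrow> 'a measure \<Rightarrow> ('a \<Rightarrow> complex) \<Rightarrow> real" where
  "Lp_norm p m f =
     (if p = \<infinity> then enn2real (esssup m (\<lambda>x. ennreal (cmod (f x))))
      else (LINT x|m. cmod (f x) powr enn2real p) powr (1 / enn2real p))"

definition Lp :: "ennreal \<Rightarrow> 'a measure \<Rightarrow> ('a \<Rightarrow> complex) set" where
  "Lp p m = {f \<in> borel_measurable m.
     if p = \<infinity> then esssup m (\<lambda>x. ennreal (cmod (f x))) < \<infinity>
     else integrable m (\<lambda>x. cmod (f x) powr enn2real p)}"

definition fourier_coeff ::
    "'g measure \<Rightarrow> ('g \<Rightarrow> complex) \<Rightarrow> ('g \<Rightarrow> complex) \<Rightarrow> complex" where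
  "fourier_coeff m f \<gamma> = (LINT x|m. f x * cnj (\<gamma> x))"

definition Hp_lambda ::
    "(nat \<Rightarrow> real) \<Rightarrow> ennreal \<Rightarrow> (real \<Rightarrow> 'g::{topological_ab_group_add, t2_space}) \<Rightarrow>
     'g measure \<Rightarrow> ('g \<Rightarrow> complex) set" where
  "Hp_lambda l p \<beta> m =
     {f \<in> Lp p m. \<forall>\<gamma> \<in> characters. fourier_coeff m f \<gamma> \<noteq> 0 \<longrightarrow> (\<exists>n. \<gamma> = char_at \<beta> (l n))}"

(* A formal Dirichlet series for a fixed frequency is its sequence of coefficients. *)
definition hardy_space ::
    "(nat \<Rightarrow> real) \<Rightarrow> ennreal \<Rightarrow> (real \<Rightarrow> 'g::{topological_ab_group_add, t2_space}) \<Rightarrow>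
     'g measure \<Rightarrow> (nat \<Rightarrow> complex) set" where
  "hardy_space l p \<beta> m =
     {a. \<exists>f \<in> Hp_lambda l p \<beta> m. \<forall>n. fourier_coeff m f (char_at \<beta> (l n)) = a n}"

(* The common p-norm of all representatives f; they agree almost everywhere because an
   integrable function is determined by its Fourier coefficients. *)
definition hardy_norm ::
    "(nat \<Rightarrow> real) \<Rightarrow> ennreal \<Rightarrow> (real \<Rightarrow> 'g::{topological_ab_group_add, t2_space}) \<Rightarrow>
     'g measure \<Rightarrow> (nat \<Rightarrow> complex) \<Rightarrow> real" where
  "hardy_norm l p \<beta> m a =
     (THE r. \<exists>f \<in> Hp_lambda l p \<beta> m.
        (\<forall>n. fourier_coeff m f (char_at \<beta> (l n)) = a n) \<and> r = Lp_norm p m f)"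

end

theory Submission
  imports Defs "HOL-Probability.Probability_Measure"
begin

text \<open>
  The Hardy space sees a Dirichlet group only through the point
  $(h_{\lambda_n}(x))_n$ of the infinite torus. Let $\Phi_G$ be this map from $G$ to the torus. Along
  the dense curve it is $\Phi_G(\beta(t)) = (e^{-i\lambda_n t})_n$, and the same formula holds for
  every other $\lambda$-Dirichlet group. Composed with $\Phi_G$, a monomial in the coordinates and
  their conjugates is a character of $G$. Its Haar integral is 1 if the monomial is constantly 1
  along the curve and 0 otherwise, a condition that does not mention $G$. As a measure on the torus
  is determined by the integrals of the monomials, the image $\mu$ of Haar measure under $\Phi_G$ is
  the same for all $\lambda$-Dirichlet groups (\<open>pushforward_torus_eq\<close>).

  It remains to see that every $f \in H_p^\lambda(G)$ is almost everywhere of the form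
  $F \circ \Phi_G$; then $F \circ \Phi_H$ has the same distribution and the same coefficients
  (\<open>hardy_function_transfer\<close>). Take for $F$ the density with respect to $\mu$ of the
  image of the complex measure $f\,dm$; this is the conditional expectation of $f$ given $\Phi_G$.
  Then $f$ and $F \circ \Phi_G$ have the same coefficients at monomial characters. At any other
  character the coefficient of $f$ vanishes by the definition of $H_p^\lambda(G)$, and that of
  $F \circ \Phi_G$ vanishes because such a character is orthogonal to all functions of $\Phi_G$.
  So $f = F \circ \Phi_G$ almost everywhere by the uniqueness theorem for Fourier coefficients of
  integrable functions (\<open>fourier_coeff_zero_imp_zero\<close>).

  By Stone--Weierstrass and regularity of Haar measure, the uniqueness theorem follows once
  characters separate the points of $G$. For this the flow $\beta$ yields an elementary argument.
  Given a continuous $f \ne 0$, form the averages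
  $g_k(y) = \frac{1}{2L}\sum_{s<2L} z^s f(y + \beta(s 2^{-k}))$ with $L = 4^k$ and $|z| = 1$. For
  a suitable $z = z_k$ their $L_2$-norm stays above a positive bound
  (\<open>exponential_average_peak\<close>). They are equicontinuous, and up to a small error they are
  multiplied by a number of modulus 1 under translation by $\beta(2^{-n})$. Every cluster point is
  therefore a non-zero multiple of a character, and this character has a non-zero coefficient in $f$,
  since otherwise it would be orthogonal to every $g_k$.
\<close>

section \<open>A spectral peak for Toeplitz correlations\<close>

lemma roots_of_unity_orthogonality:
  fixes M j k :: nat
  assumes "j < M" "k < M"
  shows "(\<Sum>r<M. cis (2 * pi * real r / real M) ^ j * cnj (cis (2 * pi * real r / real M)) ^ k)
           = (if j = k then of_nat M else 0)"
proof -
  define w where "w = cis (2 * pi * (real j - real k) / real M)"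
  have M: "real M > 0" using assms by simp
  have trm: "cis (2 * pi * real r / real M) ^ j * cnj (cis (2 * pi * real r / real M)) ^ k = w ^ r" for r
    by (simp add: w_def cis_cnj Complex.DeMoivre cis_mult algebra_simps diff_divide_distrib)
  have wM: "w ^ M = 1"
  proof -
    have "w ^ M = cis (2 * pi * of_int (int j - int k))"
      using M by (simp add: w_def Complex.DeMoivre)
    also have "\<dots> = 1" by (rule cis_multiple_2pi) auto
    finally show ?thesis .
  qed
  show ?thesis
  proof (cases "j = k")
    case True
    then show ?thesis unfolding trm by (simp add: w_def)
  next
    case False
    have "w \<noteq> 1"
    proof
      assume "w = 1"
      then have "cos (2 * pi * (real j - real k) / real M) = 1"
        by (simp add: w_def complex_eq_iff)
      then obtain n :: int where "2 * pi * (real j - real k) / real M = real_of_int n * 2 * pi"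
        unfolding cos_one_2pi_int by blast
      then have "(2 * pi) * (real j - real k) = (2 * pi) * (n * real M)" using M by (simp add: field_simps)
      then have "real j - real k = n * real M" by (subst (asm) mult_left_cancel) auto
      then have "int j - int k = n * int M"
        by (metis of_int_diff of_int_eq_iff of_int_mult of_int_of_nat_eq)
      moreover have "\<bar>int j - int k\<bar> < int M" using assms by linarith
      ultimately have "\<bar>n\<bar> * int M < int M" by (simp add: abs_mult)
      then have "n = 0" using mult_right_mono[of 1 "\<bar>n\<bar>" "int M"] by linarith
      then show False using \<open>int j - int k = n * int M\<close> False by simp
    qed
    then show ?thesis unfolding trm using False wM by (simp add: geometric_sum)
  qed
qed

text \<open>
  Discrete spectral analysis in the style of Wiener. The values $Q(z)$ play the role of a Fejer-type
  spectral density of the correlation sequence $r$. Averaging over the $4L$-th roots of unity, the mean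
  of $Q$ is $2L\,r_{00}$, while Parseval bounds the mean of $Q^2$ below by correlations. As
  $\max Q \ge \sum Q^2 / \sum Q$, strong correlations force a peak of $Q$.
\<close>
lemma toeplitz_peak:
  fixes r :: "nat \<Rightarrow> nat \<Rightarrow> complex" and Q :: "complex \<Rightarrow> real"
  assumes toeplitz: "\<And>s t u. r (s + u) (t + u) = r s t"
    and nonneg: "\<And>z. 0 \<le> Q z"
    and Q: "\<And>z. of_real (Q z) = (\<Sum>s<2*L. \<Sum>t<2*L. z ^ s * cnj z ^ t * r s t)"
    and L: "0 < L"
  obtains z where "cmod z = 1"
    "(\<Sum>s<L. \<Sum>t<L. (cmod (r s t))\<^sup>2) \<le> 2 * cmod (r 0 0) * Q z"
proof -
  \<comment> \<open>The sum of two indices below \<open>2 * L\<close> stays below \<open>M\<close>, so that no two different exponents are identified by the \<open>M\<close>-th roots of unity.\<close>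
  define M where "M = 4 * L"
  define N where "N = 2 * L"
  define \<zeta> where "\<zeta> k = cis (2 * pi * real k / real M)" for k
  have orth: "(\<Sum>k<M. \<zeta> k ^ i * cnj (\<zeta> k) ^ j) = (if i = j then of_nat M else 0)"
    if "i < M" "j < M" for i j
    unfolding \<zeta>_def by (rule roots_of_unity_orthogonality[OF that])
  have same: "r s t = r s' t'" if "s + t' = t + s'" for s t s' t'
    using toeplitz[of s s' t] toeplitz[of s' s t'] that by (simp add: ac_simps)
  have sumQ: "(\<Sum>k<M. Q (\<zeta> k)) \<le> real M * real N * cmod (r 0 0)"
  proof -
    have "of_real (\<Sum>k<M. Q (\<zeta> k)) = (\<Sum>k<M. \<Sum>s<N. \<Sum>t<N. \<zeta> k ^ s * cnj (\<zeta> k) ^ t * r s t)"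
      by (simp add: Q N_def)
    also have "\<dots> = (\<Sum>s<N. \<Sum>t<N. \<Sum>k<M. \<zeta> k ^ s * cnj (\<zeta> k) ^ t * r s t)"
      by (subst sum.swap, rule sum.cong[OF refl], rule sum.swap)
    also have "\<dots> = (\<Sum>s<N. \<Sum>t<N. (if s = t then of_nat M * r 0 0 else 0))"
    proof (intro sum.cong refl)
      fix s t assume "s \<in> {..<N}" "t \<in> {..<N}"
      then have "s < M" "t < M" by (auto simp: N_def M_def)
      then show "(\<Sum>k<M. \<zeta> k ^ s * cnj (\<zeta> k) ^ t * r s t) = (if s = t then of_nat M * r 0 0 else 0)"
        using orth[of s t] toeplitz[of 0 t 0] by (simp flip: sum_distrib_right)
    qed
    also have "\<dots> = of_nat N * of_nat M * r 0 0"
      by simp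
    finally have "cmod (of_real (\<Sum>k<M. Q (\<zeta> k))) = real N * real M * cmod (r 0 0)"
      by (simp add: norm_mult)
    then show ?thesis by (simp add: mult.commute del: of_real_sum)
  qed
  have sumQ2: "(\<Sum>k<M. (Q (\<zeta> k))\<^sup>2) \<ge> real M * (real L * (\<Sum>s<L. \<Sum>t<L. (cmod (r s t))\<^sup>2))"
  proof -
    let ?I = "{..<N} \<times> {..<N}"
    have Qp: "of_real (Q z) = (\<Sum>(s,t)\<in>?I. z ^ s * cnj z ^ t * r s t)" for z
      by (simp add: Q N_def sum.cartesian_product)
    have four: "(\<Sum>k<M. (\<zeta> k ^ (s + t') * cnj (\<zeta> k) ^ (t + s')) * (r s t * cnj (r s' t')))
          = of_real (if s + t' = t + s' then real M * (cmod (r s t))\<^sup>2 else 0)"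
      if "s < N" "t < N" "s' < N" "t' < N" for s t s' t'
    proof -
      have "s + t' < M" "t + s' < M" using that by (auto simp: N_def M_def)
      then show ?thesis
        using orth[of "s + t'" "t + s'"] same[of s t' t s'] complex_norm_square[of "r s t"]
        by (auto simp flip: sum_distrib_right)
    qed
    have "of_real (\<Sum>k<M. (Q (\<zeta> k))\<^sup>2)
       = (\<Sum>k<M. of_real (Q (\<zeta> k)) * cnj (of_real (Q (\<zeta> k))))"
      by (simp add: power2_eq_square)
    also have "\<dots> = (\<Sum>k<M. \<Sum>(s,t)\<in>?I. \<Sum>(s',t')\<in>?I.
        (\<zeta> k ^ (s + t') * cnj (\<zeta> k) ^ (t + s')) * (r s t * cnj (r s' t')))"
      by (simp add: Qp sum_product split_def power_add algebra_simps)
    also have "\<dots> = (\<Sum>(s,t)\<in>?I. \<Sum>(s',t')\<in>?I. \<Sum>k<M.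
        (\<zeta> k ^ (s + t') * cnj (\<zeta> k) ^ (t + s')) * (r s t * cnj (r s' t')))"
      unfolding split_def by (subst sum.swap, rule sum.cong[OF refl], rule sum.swap)
    also have "\<dots> = (\<Sum>(s,t)\<in>?I. \<Sum>(s',t')\<in>?I.
        of_real (if s + t' = t + s' then real M * (cmod (r s t))\<^sup>2 else 0))"
      unfolding split_def by (intro sum.cong refl four) auto
    also have "\<dots> = of_real (\<Sum>(s,t)\<in>?I. \<Sum>(s',t')\<in>?I. if s + t' = t + s' then real M * (cmod (r s t))\<^sup>2 else 0)"
      by (simp add: split_def)
    finally have eq: "(\<Sum>k<M. (Q (\<zeta> k))\<^sup>2) =
        (\<Sum>(s,t)\<in>?I. \<Sum>(s',t')\<in>?I. if s + t' = t + s' then real M * (cmod (r s t))\<^sup>2 else 0)"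
      using of_real_eq_iff by blast
    \<comment> \<open>Shifting \<open>(s, t)\<close> by every \<open>u < L\<close> gives \<open>L\<close> pairs with the same difference.\<close>
    have inner: "real L * (real M * (cmod (r s t))\<^sup>2)
        \<le> (\<Sum>(s',t')\<in>?I. if s + t' = t + s' then real M * (cmod (r s t))\<^sup>2 else 0)"
      if "s < L" "t < L" for s t
    proof -
      have "(\<lambda>u. (s + u, t + u)) ` {..<L} \<subseteq> {(s',t') \<in> ?I. s + t' = t + s'}"
        using that by (auto simp: N_def)
      then have "card ((\<lambda>u. (s + u, t + u)) ` {..<L}) \<le> card {(s',t') \<in> ?I. s + t' = t + s'}"
        by (rule card_mono[rotated]) (rule finite_subset[of _ ?I], auto)
      then have "real L \<le> real (card {(s',t') \<in> ?I. s + t' = t + s'})"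
        by (subst (asm) card_image) (auto simp: inj_on_def)
      moreover have "(\<Sum>(s',t')\<in>?I. if s + t' = t + s' then real M * (cmod (r s t))\<^sup>2 else 0)
          = real (card {(s',t') \<in> ?I. s + t' = t + s'}) * (real M * (cmod (r s t))\<^sup>2)"
        unfolding split_def by (subst sum.inter_filter[symmetric]) auto
      ultimately show ?thesis
        by (simp only:) (intro mult_right_mono, auto)
    qed
    have "real M * (real L * (\<Sum>s<L. \<Sum>t<L. (cmod (r s t))\<^sup>2))
        = (\<Sum>(s,t)\<in>{..<L}\<times>{..<L}. real L * (real M * (cmod (r s t))\<^sup>2))"
      unfolding sum.cartesian_product[symmetric] sum_distrib_left by (simp only: ac_simps)
    also have "\<dots> \<le> (\<Sum>(s,t)\<in>{..<L}\<times>{..<L}. \<Sum>(s',t')\<in>?I. if s + t' = t + s' then real M * (cmod (r s t))\<^sup>2 else 0)"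
      by (intro sum_mono) (auto intro: inner)
    also have "\<dots> \<le> (\<Sum>(s,t)\<in>?I. \<Sum>(s',t')\<in>?I. if s + t' = t + s' then real M * (cmod (r s t))\<^sup>2 else 0)"
      by (intro sum_mono2) (auto simp: N_def split: if_split_asm intro!: sum_nonneg)
    finally show ?thesis using eq by simp
  qed
  have M0: "0 < M" using L by (simp add: M_def)
  define q where "q = Max ((\<lambda>k. Q (\<zeta> k)) ` {..<M})"
  have "q \<in> (\<lambda>k. Q (\<zeta> k)) ` {..<M}" unfolding q_def using M0 by (intro Max_in) auto
  then obtain k0 where k0: "q = Q (\<zeta> k0)" by auto
  have le: "Q (\<zeta> k) \<le> q" if "k < M" for k unfolding q_def using that by (intro Max_ge) auto
  have q0: "0 \<le> q" using nonneg k0 by simp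
  have "real M * (real L * (\<Sum>s<L. \<Sum>t<L. (cmod (r s t))\<^sup>2)) \<le> (\<Sum>k<M. (Q (\<zeta> k))\<^sup>2)" by (rule sumQ2)
  also have "\<dots> \<le> (\<Sum>k<M. q * Q (\<zeta> k))"
    by (intro sum_mono) (simp add: power2_eq_square mult_right_mono le nonneg)
  also have "\<dots> \<le> q * (real M * real N * cmod (r 0 0))"
    using sumQ q0 by (simp add: mult_left_mono flip: sum_distrib_left)
  finally have "(real M * real L) * (\<Sum>s<L. \<Sum>t<L. (cmod (r s t))\<^sup>2) \<le> (real M * real L) * (2 * cmod (r 0 0) * q)"
    by (simp add: N_def algebra_simps)
  then have "(\<Sum>s<L. \<Sum>t<L. (cmod (r s t))\<^sup>2) \<le> 2 * cmod (r 0 0) * q"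
    using M0 L by (simp add: mult_le_cancel_left)
  then show thesis by (intro that[of "\<zeta> k0"]) (auto simp: k0 \<zeta>_def)
qed

section \<open>Haar measure on a Dirichlet group\<close>

locale dirichlet_haar =
  fixes \<beta> :: "real \<Rightarrow> 'g::{topological_ab_group_add, t2_space}" and m :: "'g measure"
  assumes dirichlet: "dirichlet_group \<beta>" and haar: "normalized_haar m"
begin

lemma compact_UNIV: "compact (UNIV :: 'g set)"
  and continuous_\<beta>: "continuous_on UNIV \<beta>"
  and \<beta>_add: "\<beta> (s + t) = \<beta> s + \<beta> t"
  and dense_\<beta>: "closure (range \<beta>) = UNIV"
  using dirichlet by (auto simp: dirichlet_group_def)

lemma \<beta>_0: "\<beta> 0 = 0"
  using \<beta>_add[of 0 0] by simp

lemma minus_\<beta>: "\<beta> (- t) = - \<beta> t"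
  using \<beta>_add[of "- t" t] by (simp add: \<beta>_0 eq_neg_iff_add_eq_0)

lemma sets_m [measurable_cong]: "sets m = sets borel"
  and emeasure_UNIV: "emeasure m UNIV = 1"
  and distr_translate: "distr m borel (\<lambda>y. x + y) = m"
  using haar by (auto simp: normalized_haar_def)

lemma space_m: "space m = UNIV"
  using sets_eq_imp_space_eq[OF sets_m] by simp

sublocale prob_space m
  by standard (simp add: space_m emeasure_UNIV)

lemma continuous_measurable:
  fixes f :: "'g \<Rightarrow> 'b::topological_space"
  assumes "continuous_on UNIV f" shows "f \<in> borel_measurable m"
  using borel_measurable_continuous_onI[OF assms] sets_m by (simp cong: measurable_cong_sets)

lemma continuous_translate:
  fixes f :: "'g \<Rightarrow> 'b::topological_space"
  assumes "continuous_on UNIV f" shows "continuous_on UNIV (\<lambda>y. f (y + x))"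
  by (rule continuous_on_compose2[OF assms]) (auto intro!: continuous_intros)

lemma continuous_bounded:
  fixes f :: "'g \<Rightarrow> 'b::real_normed_vector"
  assumes "continuous_on UNIV f"
  obtains B where "0 < B" "\<And>y. norm (f y) \<le> B"
proof -
  have "bounded (range f)"
    using compact_continuous_image[OF assms compact_UNIV] compact_imp_bounded by blast
  then show thesis using that by (auto simp: bounded_pos)
qed

lemma continuous_integrable:
  fixes f :: "'g \<Rightarrow> 'b::{banach, second_countable_topology}"
  assumes "continuous_on UNIV f" shows "integrable m f"
proof -
  obtain B where "\<And>y. norm (f y) \<le> B" using continuous_bounded[OF assms] by blast
  then show ?thesis
    by (intro integrable_const_bound[of _ B] continuous_measurable assms) auto
qed

lemma integral_translate:
  fixes f :: "'g \<Rightarrow> 'b::{banach, second_countable_topology}"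
  assumes "f \<in> borel_measurable m" shows "(LINT y|m. f (y + x)) = (LINT y|m. f y)"
proof -
  have "(LINT y|m. f y) = (LINT y|distr m borel (\<lambda>y. x + y). f y)"
    by (simp add: distr_translate)
  also have "\<dots> = (LINT y|m. f (x + y))"
  proof (rule integral_distr)
    show "(\<lambda>y. x + y) \<in> borel_measurable m"
      by (rule continuous_measurable) (intro continuous_intros)
    show "f \<in> borel_measurable borel"
      using assms sets_m by (simp cong: measurable_cong_sets)
  qed
  finally show ?thesis by (simp add: add.commute)
qed

lemma uniformly_continuous_translate:
  fixes f :: "'g \<Rightarrow> complex"
  assumes "continuous_on UNIV f" "0 < e"
  obtains U where "open U" "0 \<in> U" "\<And>u y. u \<in> U \<Longrightarrow> cmod (f (y + u) - f y) \<le> e"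
proof -
  have "continuous_on (UNIV \<times> UNIV) (\<lambda>(u::'g, y). f (y + u))"
    unfolding split_def by (rule continuous_on_compose2[OF assms(1)]) (auto intro!: continuous_intros)
  from continuous_on_prod_compactE[OF this compact_UNIV UNIV_I assms(2), of 0]
  obtain U where U: "0 \<in> U" "open U"
    and "\<forall>u\<in>U \<inter> UNIV. \<forall>y\<in>UNIV. dist (case (u, y) of (u, y) \<Rightarrow> f (y + u)) (case (0, y) of (u, y) \<Rightarrow> f (y + u)) \<le> e"
    by metis
  then have "cmod (f (y + u) - f y) \<le> e" if "u \<in> U" for u y
    using that by (simp add: dist_norm)
  with U show thesis by (intro that[of U])
qed

text \<open>
  Used with a neighbourhood \<open>U\<close> of 0 such that translation by its elements changes a given function
  little; the translates of the function by two points of one cell \<open>c + U\<close> are then uniformly close.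
\<close>
lemma finite_translate_cover:
  fixes U :: "'g set"
  assumes "open U" "u \<in> U"
  obtains C where "finite C" "\<And>x. \<exists>c\<in>C. x - c \<in> U"
proof -
  have "open ((\<lambda>x. x - c) -` U)" for c
    by (rule open_vimage[OF assms(1)]) (intro continuous_intros)
  moreover have "UNIV \<subseteq> (\<Union>c\<in>UNIV. (\<lambda>x. x - c) -` U)"
  proof
    fix x show "x \<in> (\<Union>c\<in>UNIV. (\<lambda>x. x - c) -` U)"
      using assms(2) by (intro UN_I[of "x - u"]) auto
  qed
  ultimately obtain C where C: "finite C" "UNIV \<subseteq> (\<Union>c\<in>C. (\<lambda>x. x - c) -` U)"
    by (rule compactE_image[OF compact_UNIV])
  have "\<exists>c\<in>C. x - c \<in> U" for x
    using C(2) by (auto simp: subset_iff)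
  with C(1) show thesis by (rule that)
qed

text \<open>
  Haar measure has full support: by compactness finitely many translates of the open set where \<open>f\<close>
  does not vanish cover the group.
\<close>
lemma integral_norm_pos:
  fixes f :: "'g \<Rightarrow> complex"
  assumes f: "continuous_on UNIV f" and "f x0 \<noteq> 0"
  shows "0 < (LINT y|m. (cmod (f y))\<^sup>2)"
proof (rule ccontr)
  assume "\<not> ?thesis"
  then have 0: "(LINT y|m. (cmod (f y))\<^sup>2) = 0"
    by (intro antisym) auto
  have c2: "continuous_on UNIV (\<lambda>y. (cmod (f y))\<^sup>2)" using f by (intro continuous_intros)
  define U where "U = {y. f y \<noteq> 0}"
  have "open U" unfolding U_def by (rule open_Collect_neq[OF f]) (intro continuous_intros)
  moreover have "x0 \<in> U" using assms by (simp add: U_def)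
  ultimately obtain C where C: "finite C" "\<And>x. \<exists>c\<in>C. x - c \<in> U"
    using finite_translate_cover by blast
  \<comment> \<open>Each translate of the integrand vanishes almost everywhere, yet at every point one of finitely many translates is positive.\<close>
  have "AE y in m. (cmod (f (y + - c)))\<^sup>2 = 0" for c
    using 0 integral_translate[OF continuous_measurable[OF c2], of "- c"]
      continuous_integrable[OF continuous_translate[OF c2], of "- c"]
    by (subst integral_nonneg_eq_0_iff_AE[symmetric]) auto
  then have "AE y in m. \<forall>c\<in>C. (cmod (f (y + - c)))\<^sup>2 = 0"
    using C(1) by (simp add: AE_finite_all)
  then have "AE y in m. False"
    by eventually_elim (use C(2) in \<open>auto simp: U_def\<close>)
  then show False by simp
qed

end

section \<open>Characters from exponential averages along the flow\<close>

context dirichlet_haar begin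

text \<open>
  The constant does not depend on $\delta$ and $L$. Cover the group by finitely many cells such
  that the translates of $f$ by two points of one cell are uniformly close. Whatever $\delta$ is, among the points $\beta(s\delta)$
  with $s < L$ at least the fraction $1 / |C|$ of all pairs lie in a common cell, and for such a pair
  the translates of $f$ are strongly correlated. The correlations depend only on $s - t$ by
  invariance of Haar measure, so \<open>toeplitz_peak\<close> applies.
\<close>
lemma exponential_average_peak:
  fixes f :: "'g \<Rightarrow> complex"
  assumes f: "continuous_on UNIV f" and pos: "0 < (LINT y|m. (cmod (f y))\<^sup>2)"
  obtains c where "0 < c"
    "\<And>\<delta> L. 0 < L \<Longrightarrow> \<exists>z. cmod z = 1 \<and>
       c * (real L)\<^sup>2 \<le> (LINT y|m. (cmod (\<Sum>s<2*L. z ^ s * f (y + \<beta> (real s * \<delta>))))\<^sup>2)"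
proof -
  define E where "E = (LINT y|m. (cmod (f y))\<^sup>2)"
  have E: "0 < E" using pos by (simp add: E_def)
  define \<epsilon> where "\<epsilon> = sqrt E / 2"
  have \<epsilon>: "0 < \<epsilon>" "2 * \<epsilon>\<^sup>2 = E / 2" using E by (auto simp: \<epsilon>_def power_divide)
  obtain U where U: "open U" "0 \<in> U" "\<And>u y. u \<in> U \<Longrightarrow> cmod (f (y + u) - f y) \<le> \<epsilon>"
    using uniformly_continuous_translate[OF f \<epsilon>(1)] by blast
  obtain C where C: "finite C" "\<And>x. \<exists>c\<in>C. x - c \<in> U"
    using finite_translate_cover[OF U(1,2)] by blast
  obtain \<kappa> where \<kappa>: "\<And>x. \<kappa> x \<in> C" "\<And>x. x - \<kappa> x \<in> U" using C(2) by metis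
  have cardC: "0 < card C" using C(1) \<kappa>(1) by (auto simp: card_gt_0_iff)
  note cont_tr = continuous_translate[OF f]
  have close: "cmod (f (y + a) - f (y + b)) \<le> 2 * \<epsilon>" if "\<kappa> a = \<kappa> b" for a b y
  proof -
    have "cmod (f (y + a) - f (y + \<kappa> a)) \<le> \<epsilon>" "cmod (f (y + b) - f (y + \<kappa> b)) \<le> \<epsilon>"
      using U(3)[OF \<kappa>(2)[of a], of "y + \<kappa> a"] U(3)[OF \<kappa>(2)[of b], of "y + \<kappa> b"] by (simp_all add: algebra_simps)
    then show ?thesis using that norm_triangle_ineq4[of "f (y + a) - f (y + \<kappa> a)" "f (y + b) - f (y + \<kappa> b)"]
      by simp
  qed
  have int2: "integrable m (\<lambda>y. f (y + a) * cnj (f (y + b)))" for a b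
    by (intro continuous_integrable continuous_intros cont_tr)
  have corr: "E / 2 \<le> cmod (LINT y|m. f (y + a) * cnj (f (y + b)))" if "\<kappa> a = \<kappa> b" for a b
  proof -
    have Ea: "(LINT y|m. (cmod (f (y + x)))\<^sup>2) = E" for x
      unfolding E_def by (rule integral_translate) (intro continuous_measurable continuous_intros f)
    have i: "integrable m (\<lambda>y. (cmod (f (y + x)))\<^sup>2)" for x
      by (intro continuous_integrable continuous_intros cont_tr)
    have polar: "Re (f (y + a) * cnj (f (y + b))) =
       ((cmod (f (y + a)))\<^sup>2 + (cmod (f (y + b)))\<^sup>2 - (cmod (f (y + a) - f (y + b)))\<^sup>2) / 2" for y
      unfolding cmod_power2 by (simp add: power2_eq_square algebra_simps)
    have "E - 2 * \<epsilon>\<^sup>2 = (LINT y|m. ((cmod (f (y + a)))\<^sup>2 + (cmod (f (y + b)))\<^sup>2 - (2 * \<epsilon>)\<^sup>2) / 2)"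
      using i[of a] i[of b] by (simp add: Ea power_mult_distrib prob_space[unfolded space_m] field_simps space_m)
    also have "\<dots> \<le> (LINT y|m. Re (f (y + a) * cnj (f (y + b))))"
    proof (rule integral_mono)
      show "((cmod (f (y + a)))\<^sup>2 + (cmod (f (y + b)))\<^sup>2 - (2 * \<epsilon>)\<^sup>2) / 2 \<le> Re (f (y + a) * cnj (f (y + b)))" for y
        unfolding polar by (intro divide_right_mono diff_mono power_mono close that) auto
      show "integrable m (\<lambda>y. ((cmod (f (y + a)))\<^sup>2 + (cmod (f (y + b)))\<^sup>2 - (2 * \<epsilon>)\<^sup>2) / 2)"
        by (intro continuous_integrable continuous_intros cont_tr) auto
      show "integrable m (\<lambda>y. Re (f (y + a) * cnj (f (y + b))))"
        by (intro continuous_integrable continuous_intros cont_tr)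
    qed
    also have "\<dots> = Re (LINT y|m. f (y + a) * cnj (f (y + b)))"
      using int2 by (rule integral_Re)
    also have "\<dots> \<le> cmod (LINT y|m. f (y + a) * cnj (f (y + b)))" by (rule complex_Re_le_cmod)
    finally show ?thesis using \<epsilon> by simp
  qed
  have key: "\<exists>z. cmod z = 1 \<and> E / (8 * card C) * (real L)\<^sup>2
      \<le> (LINT y|m. (cmod (\<Sum>s<2*L. z ^ s * f (y + \<beta> (real s * \<delta>))))\<^sup>2)" if L: "0 < L" for \<delta> L
  proof -
    define a where "a s = \<beta> (real s * \<delta>)" for s :: nat
    define r where "r s t = (LINT y|m. f (y + a s) * cnj (f (y + a t)))" for s t
    define Q where "Q z = (LINT y|m. (cmod (\<Sum>s<2*L. z ^ s * f (y + a s)))\<^sup>2)" for z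
    have a_add: "a (s + u) = a u + a s" for s u
      by (simp add: a_def \<beta>_add[symmetric] algebra_simps)
    have "r (s + u) (t + u) = r s t" for s t u
      unfolding r_def a_add add.assoc[symmetric]
      by (rule integral_translate) (intro continuous_measurable continuous_intros cont_tr)
    moreover have "0 \<le> Q z" for z unfolding Q_def by simp
    moreover have "of_real (Q z) = (\<Sum>s<2*L. \<Sum>t<2*L. z ^ s * cnj z ^ t * r s t)" for z
    proof -
      have "of_real (Q z) = (LINT y|m. complex_of_real ((cmod (\<Sum>s<2*L. z ^ s * f (y + a s)))\<^sup>2))"
        unfolding Q_def by (rule integral_complex_of_real[symmetric])
      also have "\<dots> = (LINT y|m. (\<Sum>s<2*L. \<Sum>t<2*L. z ^ s * cnj z ^ t * (f (y + a s) * cnj (f (y + a t)))))"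
        unfolding complex_norm_square by (simp add: sum_product algebra_simps)
      also have "\<dots> = (\<Sum>s<2*L. \<Sum>t<2*L. z ^ s * cnj z ^ t * r s t)"
        unfolding r_def using int2 by (simp add: Bochner_Integration.integral_sum)
      finally show ?thesis .
    qed
    ultimately obtain z where z: "cmod z = 1"
      and zQ: "(\<Sum>s<L. \<Sum>t<L. (cmod (r s t))\<^sup>2) \<le> 2 * cmod (r 0 0) * Q z"
      using toeplitz_peak[of r Q L] L by blast
    have "of_real E = r 0 0"
      unfolding r_def a_def E_def integral_complex_of_real[symmetric] complex_norm_square by (simp add: \<beta>_0)
    then have r00: "cmod (r 0 0) = E" using E by (metis abs_of_pos norm_of_real)
    define P :: real where "P = (\<Sum>s<L. \<Sum>t<L. if \<kappa> (a s) = \<kappa> (a t) then 1 else 0)"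
    define n where "n c = (\<Sum>s<L. if \<kappa> (a s) = c then 1 else 0 :: real)" for c
    \<comment> \<open>Cauchy--Schwarz for the occupation numbers of the cells counts the pairs in a common cell.\<close>
    have "(\<Sum>c\<in>C. n c) = real L"
      unfolding n_def using C(1) \<kappa>(1) by (subst sum.swap) (simp add: sum.delta)
    then have "(real L)\<^sup>2 \<le> (\<Sum>c\<in>C. (n c)\<^sup>2) * card C"
      using sum_squared_le_sum_of_squares[of n C] by simp
    also have "(\<Sum>c\<in>C. (n c)\<^sup>2) = (\<Sum>c\<in>C. \<Sum>s<L. \<Sum>t<L. if \<kappa> (a s) = c \<and> \<kappa> (a t) = c then 1 else 0)"
      unfolding n_def power2_eq_square sum_product by (intro sum.cong refl) auto
    also have "\<dots> = (\<Sum>s<L. \<Sum>t<L. \<Sum>c\<in>C. if \<kappa> (a s) = c \<and> \<kappa> (a t) = c then 1 else 0)"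
      by (subst sum.swap, rule sum.cong[OF refl], rule sum.swap)
    also have "\<dots> = P"
    unfolding P_def
    proof (intro sum.cong refl)
      fix s t
      have "(\<Sum>c\<in>C. if \<kappa> (a s) = c \<and> \<kappa> (a t) = c then 1 else 0 :: real)
        = (\<Sum>c\<in>C. if \<kappa> (a s) = c then (if \<kappa> (a s) = \<kappa> (a t) then 1 else 0) else 0)"
        by (intro sum.cong refl) auto
      then show "(\<Sum>c\<in>C. if \<kappa> (a s) = c \<and> \<kappa> (a t) = c then 1 else 0 :: real) = (if \<kappa> (a s) = \<kappa> (a t) then 1 else 0)"
        using C(1) \<kappa>(1) by (simp add: sum.delta)
    qed
    finally have pairs: "(real L)\<^sup>2 \<le> P * real (card C)" .
    have "E\<^sup>2 / 4 * P \<le> (\<Sum>s<L. \<Sum>t<L. (cmod (r s t))\<^sup>2)"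
      unfolding P_def sum_distrib_left
    proof (intro sum_mono)
      fix s t
      show "E\<^sup>2 / 4 * (if \<kappa> (a s) = \<kappa> (a t) then 1 else 0) \<le> (cmod (r s t))\<^sup>2"
        using power_mono[OF corr[of "a s" "a t"], of 2] E by (auto simp: r_def power_divide)
    qed
    also have "\<dots> \<le> 2 * E * Q z" using zQ by (simp add: r00)
    finally have "E * (E * P) \<le> E * (8 * Q z)"
      by (simp add: power2_eq_square)
    then have "E * P \<le> 8 * Q z"
      using E by (simp only: mult_le_cancel_left_pos)
    then have "card C * (E * P) \<le> card C * (8 * Q z)"
      using cardC by (intro mult_left_mono) auto
    moreover have "E * (real L)\<^sup>2 \<le> E * (P * card C)"
      using pairs E by (intro mult_left_mono) auto
    ultimately have "E * (real L)\<^sup>2 \<le> 8 * card C * Q z" by (simp add: algebra_simps)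
    then have "E / (8 * card C) * (real L)\<^sup>2 \<le> Q z" using cardC by (simp add: field_simps)
    then show ?thesis using z unfolding Q_def a_def by blast
  qed
  show thesis using that[OF _ key] E cardC by simp
qed

end

text \<open>
  By Tychonoff there is a pointwise cluster point, but the domain need not be countable, so in general
  no subsequence converges. The filter \<open>F\<close> replaces the subsequence.
\<close>
lemma bounded_sequence_pointwise_cluster:
  fixes g :: "nat \<Rightarrow> 'a \<Rightarrow> complex"
  assumes "\<And>k y. cmod (g k y) \<le> B"
  obtains \<phi> F where "F \<noteq> bot" "F \<le> sequentially" "\<And>y. ((\<lambda>k. g k y) \<longlongrightarrow> \<phi> y) F"
proof -
  have "compact (PiE UNIV (\<lambda>_::'a. cball (0::complex) B))"
    unfolding compactin_euclidean_iff[symmetric] euclidean_product_topology[symmetric] compactin_PiE by simp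
  then have "compact {h::'a \<Rightarrow> complex. \<forall>y. cmod (h y) \<le> B}"
    by (simp add: PiE_UNIV_domain Pi_def)
  moreover have "filtermap g sequentially \<noteq> bot" by (simp add: filtermap_bot_iff)
  moreover have "eventually (\<lambda>h. h \<in> {h. \<forall>y. cmod (h y) \<le> B}) (filtermap g sequentially)"
    using assms by (simp add: eventually_filtermap)
  ultimately obtain \<phi> where \<phi>: "inf (nhds \<phi>) (filtermap g sequentially) \<noteq> bot"
    unfolding compact_filter by blast
  define F where "F = inf sequentially (filtercomap g (nhds \<phi>))"
  have "F \<noteq> bot"
  proof
    assume "F = bot"
    then have "eventually (\<lambda>_. False) F" by simp
    then obtain P Q where P: "eventually P sequentially" and "eventually Q (filtercomap g (nhds \<phi>))"
      and PQ: "\<And>k. P k \<Longrightarrow> Q k \<Longrightarrow> False"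
      unfolding F_def eventually_inf by blast
    then obtain R where R: "eventually R (nhds \<phi>)" and RQ: "\<And>k. R (g k) \<Longrightarrow> Q k"
      unfolding eventually_filtercomap by blast
    have "eventually (\<lambda>k. \<not> R (g k)) sequentially"
      using P by eventually_elim (use PQ RQ in blast)
    with R have "eventually (\<lambda>_. False) (inf (nhds \<phi>) (filtermap g sequentially))"
      unfolding eventually_inf eventually_filtermap
      by (intro exI[of _ R] exI[of _ "\<lambda>h. \<not> R h"]) auto
    then show False using \<phi> by (simp add: trivial_limit_def)
  qed
  moreover have "F \<le> sequentially" by (simp add: F_def)
  moreover have "((\<lambda>k. g k y) \<longlongrightarrow> \<phi> y) F" for y
  proof -
    have "filterlim g (nhds \<phi>) F"
      unfolding filterlim_iff_le_filtercomap F_def by simp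
    then show ?thesis
      by (rule continuous_on_tendsto_compose[OF continuous_on_product_coordinates[of y]]) auto
  qed
  ultimately show thesis by (rule that)
qed

lemma closed_subgroup_dyadic:
  fixes S :: "real set"
  assumes closed: "closed S"
    and dyadic: "\<And>n. 1 / 2 ^ n \<in> S"
    and zero: "0 \<in> S" and add: "\<And>s t. s \<in> S \<Longrightarrow> t \<in> S \<Longrightarrow> s + t \<in> S" and minus: "\<And>t. t \<in> S \<Longrightarrow> - t \<in> S"
  shows "S = UNIV"
proof -
  have mult: "real k * t \<in> S" if "t \<in> S" for k t
    by (induction k) (use that zero add in \<open>auto simp: distrib_right\<close>)
  have nonneg: "r \<in> S" if "0 \<le> r" for r
  proof -
    define q where "q n = real (nat \<lfloor>r * 2 ^ n\<rfloor>) * (1 / 2 ^ n)" for n :: nat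
    have "q n \<in> S" for n unfolding q_def by (intro mult dyadic)
    moreover have "q \<longlonglongrightarrow> r"
    proof (rule LIM_zero_cancel, rule Lim_null_comparison)
      show "eventually (\<lambda>n. norm (q n - r) \<le> (1/2) ^ n) sequentially"
      proof (intro always_eventually allI)
        fix n
        have "real (nat \<lfloor>r * 2 ^ n\<rfloor>) = of_int \<lfloor>r * 2 ^ n\<rfloor>" using that by simp
        then have "\<bar>real (nat \<lfloor>r * 2 ^ n\<rfloor>) - r * 2 ^ n\<bar> \<le> 1" by linarith
        moreover have "q n - r = (real (nat \<lfloor>r * 2 ^ n\<rfloor>) - r * 2 ^ n) / 2 ^ n"
          by (simp add: q_def diff_divide_distrib)
        ultimately show "norm (q n - r) \<le> (1/2) ^ n"
          by (simp add: power_one_over divide_right_mono)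
      qed
    qed (auto intro: LIMSEQ_power_zero)
    ultimately show ?thesis using closed_sequentially[OF closed] by blast
  qed
  have "r \<in> S" for r using nonneg[of r] minus[OF nonneg[of "- r"]] by (cases "0 \<le> r") auto
  then show ?thesis by blast
qed

context dirichlet_haar begin

text \<open>
  The hypothesis says that translation by $\beta(2^{-n})$ multiplies $\phi$ by a constant. The
  elements with this property form a closed subgroup; it contains the dyadic points of the curve,
  hence the whole curve, hence everything. The resulting multiplicative function is bounded because the
  group is compact, which forces modulus 1.
\<close>
lemma proportional_translates_imp_character:
  fixes \<phi> :: "'g \<Rightarrow> complex"
  assumes cont: "continuous_on UNIV \<phi>" and nz: "\<phi> z0 \<noteq> 0"
    and rel: "\<And>x y n. \<phi> (y + \<beta> (1 / 2 ^ n)) * \<phi> x = \<phi> (x + \<beta> (1 / 2 ^ n)) * \<phi> y"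
  shows "(\<lambda>w. \<phi> (z0 + w) / \<phi> z0) \<in> characters"
proof -
  define S where "S = {w. \<forall>x y. \<phi> (y + w) * \<phi> x = \<phi> (x + w) * \<phi> y}"
  have cont': "continuous_on UNIV (\<lambda>w. \<phi> (x + w))" for x
    by (rule continuous_on_compose2[OF cont]) (auto intro!: continuous_intros)
  have closed: "closed S"
    unfolding S_def by (intro closed_Collect_all closed_Collect_eq continuous_intros cont')
  have S_iff: "w \<in> S \<longleftrightarrow> (\<forall>y. \<phi> (y + w) = \<phi> (z0 + w) / \<phi> z0 * \<phi> y)" for w
  proof
    assume "w \<in> S"
    then show "\<forall>y. \<phi> (y + w) = \<phi> (z0 + w) / \<phi> z0 * \<phi> y"
      using nz by (auto simp: S_def field_simps)
  next
    assume *: "\<forall>y. \<phi> (y + w) = \<phi> (z0 + w) / \<phi> z0 * \<phi> y"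
    show "w \<in> S" unfolding S_def
    proof (clarify)
      fix x y
      show "\<phi> (y + w) * \<phi> x = \<phi> (x + w) * \<phi> y"
        using *[rule_format, of x] *[rule_format, of y] by (simp only: ac_simps)
    qed
  qed
  have add: "w + w' \<in> S" if "w \<in> S" "w' \<in> S" for w w'
    unfolding S_iff
  proof
    fix y
    have "\<phi> (y + w + w') = \<phi> (z0 + w') / \<phi> z0 * (\<phi> (z0 + w) / \<phi> z0 * \<phi> y)" for y
      using that unfolding S_iff by metis
    from this[of y] this[of z0] show "\<phi> (y + (w + w')) = \<phi> (z0 + (w + w')) / \<phi> z0 * \<phi> y"
      using nz by (simp add: add.assoc)
  qed
  have minus: "- w \<in> S" if "w \<in> S" for w
    unfolding S_def
  proof (clarify)
    fix x y
    have "\<phi> (y + - w + w) * \<phi> (x + - w) = \<phi> (x + - w + w) * \<phi> (y + - w)"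
      using that unfolding S_def by blast
    then show "\<phi> (y + - w) * \<phi> x = \<phi> (x + - w) * \<phi> y" by (simp add: algebra_simps)
  qed
  have "{t. \<beta> t \<in> S} = UNIV"
  proof (rule closed_subgroup_dyadic)
    show "closed {t. \<beta> t \<in> S}"
      using closed_vimage[OF closed continuous_\<beta>] by (simp add: vimage_def)
  qed (use rel add minus in \<open>auto simp: S_def \<beta>_0 \<beta>_add minus_\<beta>\<close>)
  then have "closure (range \<beta>) \<subseteq> S"
    using closed by (intro closure_minimal) auto
  then have "w \<in> S" for w by (auto simp: dense_\<beta>)
  then have mult: "\<phi> (y + w) = \<phi> (z0 + w) / \<phi> z0 * \<phi> y" for w y
    unfolding S_iff by blast
  define \<gamma> where "\<gamma> w = \<phi> (z0 + w) / \<phi> z0" for w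
  have \<gamma>_cont: "continuous_on UNIV \<gamma>"
    unfolding \<gamma>_def by (intro continuous_intros cont' ballI nz)
  have \<gamma>_add: "\<gamma> (x + y) = \<gamma> x * \<gamma> y" for x y
    using mult[of "z0 + x" y] nz by (simp add: \<gamma>_def add.assoc)
  have \<gamma>_0: "\<gamma> 0 = 1" using nz by (simp add: \<gamma>_def)
  obtain w1 where w1: "\<And>w. cmod (\<gamma> w) \<le> cmod (\<gamma> w1)"
    using continuous_attains_sup[OF compact_UNIV, of "\<lambda>w. cmod (\<gamma> w)"] \<gamma>_cont
    by (auto intro: continuous_intros)
  have "1 \<le> cmod (\<gamma> w1)" using w1[of 0] by (simp add: \<gamma>_0)
  then have le1: "cmod (\<gamma> w) \<le> 1" for w
    using w1[of "w1 + w"] mult_le_cancel_left_pos[of "cmod (\<gamma> w1)" "cmod (\<gamma> w)" 1]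
    by (simp only: \<gamma>_add norm_mult mult_1_right)
  have "cmod (\<gamma> w) = 1" for w
  proof -
    have "cmod (\<gamma> w) * cmod (\<gamma> (- w)) = 1"
      using \<gamma>_add[of w "- w"] by (simp add: \<gamma>_0 flip: norm_mult)
    then show ?thesis using le1[of w] le1[of "- w"] mult_left_le[of "cmod (\<gamma> (- w))" "cmod (\<gamma> w)"] by simp
  qed
  then have "\<gamma> \<in> characters" using \<gamma>_cont \<gamma>_add by (auto simp: characters_def)
  then show ?thesis unfolding \<gamma>_def .
qed

text \<open>
  If $f \ne 0$, a cluster point $\phi$ of suitable averages of translates of $f$ is a non-zero multiple
  of a character. All averages lie in the span of the translates of $f$, so they are orthogonal to
  every character if $f$ is; passing to the limit, the character would be orthogonal to itself.
\<close>
lemma fourier_coeff_zero_imp_zero_continuous: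
  fixes f :: "'g \<Rightarrow> complex"
  assumes f: "continuous_on UNIV f"
    and coeff: "\<And>\<gamma>. \<gamma> \<in> characters \<Longrightarrow> fourier_coeff m f \<gamma> = 0"
  shows "f x = 0"
proof (rule ccontr)
  assume "f x \<noteq> 0"
  then have "0 < (LINT y|m. (cmod (f y))\<^sup>2)" by (rule integral_norm_pos[OF f])
  from exponential_average_peak[OF f this] obtain c where c: "0 < c" and
    peak: "\<And>\<delta> L. 0 < L \<Longrightarrow> \<exists>z. cmod z = 1 \<and>
       c * (real L)\<^sup>2 \<le> (LINT y|m. (cmod (\<Sum>s<2*L. z ^ s * f (y + \<beta> (real s * \<delta>))))\<^sup>2)"
    by blast
  obtain B where B: "0 < B" "\<And>y. cmod (f y) \<le> B" using continuous_bounded[OF f] by blast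
  define \<delta> :: "nat \<Rightarrow> real" where "\<delta> k = 1 / 2 ^ k" for k :: nat
  \<comment> \<open>A step of length \<open>\<delta> k\<close> costs an error of order \<open>1 / L k\<close> and at most \<open>2 ^ k\<close> steps are made, so the total error is of order \<open>(1/2) ^ k\<close>.\<close>
  define L where "L k = (4::nat) ^ k" for k :: nat
  have L: "0 < L k" for k by (simp add: L_def)
  have "\<forall>k. \<exists>z. cmod z = 1 \<and> c * (real (L k))\<^sup>2
      \<le> (LINT y|m. (cmod (\<Sum>s<2*L k. z ^ s * f (y + \<beta> (real s * \<delta> k))))\<^sup>2)"
    using peak[OF L] by blast
  from choice[OF this] obtain z where "\<forall>k. cmod (z k) = 1 \<and> c * (real (L k))\<^sup>2
      \<le> (LINT y|m. (cmod (\<Sum>s<2*L k. z k ^ s * f (y + \<beta> (real s * \<delta> k))))\<^sup>2)" ..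
  then have z: "cmod (z k) = 1"
    and zpeak: "c * (real (L k))\<^sup>2
      \<le> (LINT y|m. (cmod (\<Sum>s<2*L k. z k ^ s * f (y + \<beta> (real s * \<delta> k))))\<^sup>2)" for k
    by auto
  define g where "g k y = (\<Sum>s<2*L k. z k ^ s * f (y + \<beta> (real s * \<delta> k))) / of_nat (2 * L k)" for k y
  have g_cont: "continuous_on UNIV (g k)" for k
    unfolding g_def by (intro continuous_intros continuous_translate[OF f]) (use L[of k] in auto)
  have avg: "cmod ((\<Sum>s<2*L k. z k ^ s * h s) / of_nat (2 * L k)) \<le> e"
    if "\<And>s. cmod (h s) \<le> e" for h e k
  proof -
    have "cmod (\<Sum>s<2*L k. z k ^ s * h s) \<le> of_nat (card {..<2*L k}) * e"
      by (rule sum_norm_bound) (simp add: norm_mult norm_power z that)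
    then show ?thesis using L[of k] by (simp add: norm_divide field_simps norm_mult)
  qed
  have g_bound: "cmod (g k y) \<le> B" for k y
    unfolding g_def by (rule avg) (rule B)
  have g_equi: "cmod (g k (y + u) - g k y) \<le> e" if "\<And>y. cmod (f (y + u) - f y) \<le> e" for k y u e
  proof -
    have "g k (y + u) - g k y =
        (\<Sum>s<2*L k. z k ^ s * (f ((y + \<beta> (real s * \<delta> k)) + u) - f (y + \<beta> (real s * \<delta> k)))) / of_nat (2 * L k)"
      unfolding g_def diff_divide_distrib[symmetric] sum_subtractf[symmetric] by (simp add: algebra_simps)
    then show ?thesis using avg[of "\<lambda>s. f ((y + \<beta> (real s * \<delta> k)) + u) - f (y + \<beta> (real s * \<delta> k))", OF that] by simp
  qed
  \<comment> \<open>Multiplying by \<open>z k\<close> and translating by one step shifts the summation index by one; only the two end terms survive.\<close>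
  have g_step: "cmod (z k * g k (y + \<beta> (\<delta> k)) - g k y) \<le> B / L k" for k y
  proof -
    have "z k * g k (y + \<beta> (\<delta> k)) = (\<Sum>s<2*L k. z k ^ Suc s * f (y + \<beta> (real (Suc s) * \<delta> k))) / of_nat (2 * L k)"
      unfolding g_def by (simp add: sum_distrib_left \<beta>_add algebra_simps)
    then have "z k * g k (y + \<beta> (\<delta> k)) - g k y =
       (\<Sum>s<2*L k. z k ^ Suc s * f (y + \<beta> (real (Suc s) * \<delta> k)) - z k ^ s * f (y + \<beta> (real s * \<delta> k))) / of_nat (2 * L k)"
      unfolding g_def by (simp only: sum_subtractf diff_divide_distrib)
    also have "\<dots> = (z k ^ (2*L k) * f (y + \<beta> (real (2*L k) * \<delta> k)) - f y) / of_nat (2 * L k)"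
      by (subst sum_lessThan_telescope) (simp add: \<beta>_0)
    also have "cmod \<dots> \<le> (B + B) / real (2 * L k)"
      unfolding norm_divide norm_of_nat
      by (intro divide_right_mono order_trans[OF norm_triangle_ineq4] add_mono)
        (auto simp: norm_mult norm_power z B)
    finally show ?thesis by simp
  qed
  have g_steps: "cmod (z k ^ j * g k (y + \<beta> (real j * \<delta> k)) - g k y) \<le> real j * (B / L k)" for k j y
  proof (induction j arbitrary: y)
    case 0
    then show ?case by (simp add: \<beta>_0)
  next
    case (Suc j)
    let ?y = "y + \<beta> (\<delta> k)"
    have eq: "z k ^ Suc j * g k (y + \<beta> (real (Suc j) * \<delta> k)) - g k y
       = z k * (z k ^ j * g k (?y + \<beta> (real j * \<delta> k)) - g k ?y) + (z k * g k ?y - g k y)"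
      by (simp add: \<beta>_add algebra_simps)
    have "cmod (z k * (z k ^ j * g k (?y + \<beta> (real j * \<delta> k)) - g k ?y)) \<le> real j * (B / L k)"
      using Suc.IH[of ?y] by (simp only: norm_mult z mult_1)
    from norm_triangle_mono[OF this g_step[of k y]] show ?case unfolding eq
      by (simp add: distrib_right add_divide_distrib add.commute)
  qed
  obtain \<phi> F where F: "F \<noteq> bot" "F \<le> sequentially" and lim: "\<And>y. ((\<lambda>k. g k y) \<longlongrightarrow> \<phi> y) F"
    using bounded_sequence_pointwise_cluster[of g B] g_bound by metis
  have \<phi>_equi: "cmod (\<phi> (y + u) - \<phi> y) \<le> e" if "\<And>y. cmod (f (y + u) - f y) \<le> e" for y u e
  proof (rule tendsto_upperbound)
    show "((\<lambda>k. cmod (g k (y + u) - g k y)) \<longlongrightarrow> cmod (\<phi> (y + u) - \<phi> y)) F"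
      by (intro tendsto_norm tendsto_diff lim)
    show "\<forall>\<^sub>F k in F. cmod (g k (y + u) - g k y) \<le> e"
      by (intro always_eventually allI g_equi that)
    show "F \<noteq> bot" by (rule F(1))
  qed
  have \<phi>_cont: "continuous_on UNIV \<phi>"
  proof (rule continuous_at_imp_continuous_on, rule ballI)
    fix y show "isCont \<phi> y"
      unfolding continuous_at tendsto_iff
    proof (intro allI impI)
      fix e :: real assume "0 < e"
      then have e2: "0 < e / 2" by simp
      obtain U where U: "open U" "0 \<in> U" "\<And>u y. u \<in> U \<Longrightarrow> cmod (f (y + u) - f y) \<le> e / 2"
        using uniformly_continuous_translate[OF f e2] by blast
      have "open ((\<lambda>w. w - y) -` U)" by (rule open_vimage[OF U(1)]) (intro continuous_intros)
      moreover have "dist (\<phi> w) (\<phi> y) < e" if "w \<in> (\<lambda>w. w - y) -` U" for w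
        using \<phi>_equi[OF U(3), of "w - y" y] that \<open>0 < e\<close> by (simp add: dist_norm)
      ultimately show "\<forall>\<^sub>F w in at y. dist (\<phi> w) (\<phi> y) < e"
        unfolding eventually_at_topological using U(2) by (intro exI[of _ "(\<lambda>w. w - y) -` U"]) auto
    qed
  qed
  \<comment> \<open>For an equicontinuous family on a compact space pointwise convergence is uniform. Dominated convergence would not do here, as it fails for general filters.\<close>
  have uniform: "\<forall>\<^sub>F k in F. \<forall>y. cmod (g k y - \<phi> y) \<le> e" if "0 < e" for e
  proof -
    have e3: "0 < e / 3" using that by simp
    obtain U where U: "open U" "0 \<in> U" "\<And>u y. u \<in> U \<Longrightarrow> cmod (f (y + u) - f y) \<le> e / 3"
      using uniformly_continuous_translate[OF f e3] by blast
    obtain C where C: "finite C" "\<And>x. \<exists>c\<in>C. x - c \<in> U"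
      using finite_translate_cover[OF U(1,2)] by blast
    have "\<forall>\<^sub>F k in F. \<forall>c\<in>C. dist (g k c) (\<phi> c) < e / 3"
      using C(1) that lim by (intro eventually_ball_finite ballI tendstoD) auto
    then show ?thesis
    proof eventually_elim
      case (elim k)
      show ?case
      proof
        fix y
        obtain c where "c \<in> C" "y - c \<in> U" using C(2) by blast
        then have "cmod (g k y - g k c) \<le> e / 3" "cmod (\<phi> y - \<phi> c) \<le> e / 3" "cmod (g k c - \<phi> c) \<le> e / 3"
          using g_equi[OF U(3), of "y - c" k c] \<phi>_equi[OF U(3), of "y - c" c] elim
          by (auto simp: dist_norm intro: less_imp_le)
        then show "cmod (g k y - \<phi> y) \<le> e"
          using norm_triangle_ineq4[of "g k y - g k c + (g k c - \<phi> c)" "\<phi> y - \<phi> c"]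
            norm_triangle_ineq[of "g k y - g k c" "g k c - \<phi> c"] by simp
      qed
    qed
  qed
  have g_energy: "c / 4 \<le> (LINT y|m. (cmod (g k y))\<^sup>2)" for k
  proof -
    have "(LINT y|m. (cmod (g k y))\<^sup>2)
        = (LINT y|m. (cmod (\<Sum>s<2*L k. z k ^ s * f (y + \<beta> (real s * \<delta> k))))\<^sup>2) / (real (2 * L k))\<^sup>2"
      unfolding g_def norm_divide power_divide norm_of_nat by simp
    also have "\<dots> \<ge> (c * (real (L k))\<^sup>2) / (real (2 * L k))\<^sup>2"
      by (rule divide_right_mono[OF zpeak]) simp
    finally show ?thesis using L[of k] by (simp add: power_mult_distrib)
  qed
  have "\<exists>z0. \<phi> z0 \<noteq> 0"
  proof (rule ccontr)
    assume "\<nexists>z0. \<phi> z0 \<noteq> 0"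
    then have "\<forall>\<^sub>F k in F. \<forall>y. cmod (g k y) \<le> sqrt c / 4"
      using uniform[of "sqrt c / 4"] c by simp
    then obtain k where k: "\<And>y. cmod (g k y) \<le> sqrt c / 4"
      using eventually_happens'[OF F(1)] by blast
    have "(LINT y|m. (cmod (g k y))\<^sup>2) \<le> (LINT y|m. (sqrt c / 4)\<^sup>2)"
      by (intro integral_mono continuous_integrable continuous_intros g_cont power_mono k) auto
    also have "\<dots> = c / 16" using c by (simp add: prob_space power_divide)
    finally show False using g_energy[of k] c by simp
  qed
  then obtain z0 where z0: "\<phi> z0 \<noteq> 0" by blast
  have rel: "\<phi> (y + \<beta> (1 / 2 ^ n)) * \<phi> x = \<phi> (x + \<beta> (1 / 2 ^ n)) * \<phi> y" for x y n
  proof -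
    let ?d = "\<beta> (1 / 2 ^ n)"
    have est: "cmod (g k (y + ?d) * g k x - g k (x + ?d) * g k y) \<le> 2 * B\<^sup>2 * (1/2) ^ k" if "n \<le> k" for k
    proof -
      define j where "j = (2::nat) ^ (k - n)"
      have jd: "real j * \<delta> k = 1 / 2 ^ n" unfolding j_def \<delta>_def of_nat_power of_nat_numeral
        using that by (subst power_diff) auto
      have "real j \<le> 2 ^ k" by (simp add: j_def)
      moreover have "real (L k) = 2 ^ k * 2 ^ k" by (simp add: L_def flip: power_mult_distrib)
      ultimately have jB: "real j * (B / L k) \<le> B * (1/2) ^ k"
        using B(1) by (simp add: power_one_over field_simps)
      \<comment> \<open>The unknown multiplier \<open>w\<close> depends on \<open>k\<close>; it cancels in the antisymmetric expression.\<close>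
      define w where "w = z k ^ j"
      have w: "cmod w = 1" by (simp add: w_def norm_power z)
      have shift: "cmod (w * g k (v + ?d) - g k v) \<le> B * (1/2) ^ k" for v
        using g_steps[of k j v] jB unfolding w_def jd by simp
      have "cmod (g k (y + ?d) * g k x - g k (x + ?d) * g k y)
         = cmod (w * (g k (y + ?d) * g k x - g k (x + ?d) * g k y))"
        by (simp add: norm_mult w)
      also have "w * (g k (y + ?d) * g k x - g k (x + ?d) * g k y)
         = (w * g k (y + ?d) - g k y) * g k x - (w * g k (x + ?d) - g k x) * g k y"
        by (simp add: algebra_simps)
      also have "cmod \<dots> \<le> B * (1/2) ^ k * B + B * (1/2) ^ k * B"
        using B(1) by (intro order_trans[OF norm_triangle_ineq4] add_mono)
          (auto simp only: norm_mult intro!: mult_mono shift g_bound, auto)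
      finally show ?thesis by (simp add: power2_eq_square algebra_simps)
    qed
    have "((\<lambda>k. g k (y + ?d) * g k x - g k (x + ?d) * g k y) \<longlongrightarrow> 0) F"
    proof (rule Lim_null_comparison)
      show "\<forall>\<^sub>F k in F. cmod (g k (y + ?d) * g k x - g k (x + ?d) * g k y) \<le> 2 * B\<^sup>2 * (1/2) ^ k"
        using filter_leD[OF F(2) eventually_ge_at_top[of n]] by eventually_elim (rule est)
      have "((\<lambda>k. 2 * B\<^sup>2 * (1/2) ^ k) \<longlonglongrightarrow> 2 * B\<^sup>2 * 0)"
        by (intro tendsto_intros LIMSEQ_power_zero) auto
      then show "((\<lambda>k. 2 * B\<^sup>2 * (1/2) ^ k) \<longlongrightarrow> 0) F"
        using tendsto_mono[OF F(2)] by simp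
    qed
    moreover have "((\<lambda>k. g k (y + ?d) * g k x - g k (x + ?d) * g k y) \<longlongrightarrow> \<phi> (y + ?d) * \<phi> x - \<phi> (x + ?d) * \<phi> y) F"
      by (intro tendsto_intros lim)
    ultimately show ?thesis using tendsto_unique[OF F(1)] by fastforce
  qed
  define \<gamma> where "\<gamma> = (\<lambda>w. \<phi> (z0 + w) / \<phi> z0)"
  have \<gamma>: "\<gamma> \<in> characters"
    unfolding \<gamma>_def by (rule proportional_translates_imp_character[OF \<phi>_cont z0 rel])
  then have \<gamma>_cont: "continuous_on UNIV \<gamma>" and \<gamma>_norm: "\<And>x. cmod (\<gamma> x) = 1"
    and \<gamma>_add: "\<And>x y. \<gamma> (x + y) = \<gamma> x * \<gamma> y" by (auto simp: characters_def)
  have \<phi>\<gamma>: "\<phi> y = \<phi> z0 * \<gamma> (- z0) * \<gamma> y" for y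
  proof -
    have "\<phi> y = \<phi> z0 * \<gamma> (- z0 + y)" using z0 by (simp add: \<gamma>_def)
    then show ?thesis by (simp only: \<gamma>_add mult.assoc)
  qed
  have g_coeff: "(LINT y|m. g k y * cnj (\<gamma> y)) = 0" for k
  proof -
    have tr: "(LINT y|m. f (y + a) * cnj (\<gamma> y)) = 0" for a
    proof -
      have "f (y + a) * cnj (\<gamma> y) = \<gamma> a * (f (y + a) * cnj (\<gamma> (y + a)))" for y
        using complex_norm_square[of "\<gamma> a"] by (simp add: \<gamma>_add \<gamma>_norm)
      then have "(LINT y|m. f (y + a) * cnj (\<gamma> y)) = \<gamma> a * (LINT y|m. f (y + a) * cnj (\<gamma> (y + a)))"
        unfolding integral_mult_right_zero[symmetric] by (intro Bochner_Integration.integral_cong refl)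
      also have "(LINT y|m. f (y + a) * cnj (\<gamma> (y + a))) = (LINT y|m. f y * cnj (\<gamma> y))"
        by (rule integral_translate) (intro continuous_measurable continuous_intros f \<gamma>_cont)
      finally show ?thesis using coeff[OF \<gamma>] by (simp add: fourier_coeff_def)
    qed
    have "(LINT y|m. g k y * cnj (\<gamma> y)) =
        (LINT y|m. (\<Sum>s<2*L k. z k ^ s * (f (y + \<beta> (real s * \<delta> k)) * cnj (\<gamma> y))) / of_nat (2 * L k))"
      unfolding g_def by (simp add: sum_distrib_right mult.assoc)
    also have "\<dots> = (\<Sum>s<2*L k. z k ^ s * (LINT y|m. f (y + \<beta> (real s * \<delta> k)) * cnj (\<gamma> y))) / of_nat (2 * L k)"
      by (subst integral_divide_zero, subst Bochner_Integration.integral_sum)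
        (auto intro!: continuous_integrable continuous_intros continuous_translate[OF f] \<gamma>_cont)
    finally show ?thesis by (simp add: tr)
  qed
  have "(LINT y|m. \<phi> y * cnj (\<gamma> y)) = \<phi> z0 * \<gamma> (- z0)"
  proof -
    have "\<phi> y * cnj (\<gamma> y) = \<phi> z0 * \<gamma> (- z0)" for y
      using complex_norm_square[of "\<gamma> y"] by (simp add: \<phi>\<gamma>[of y] \<gamma>_norm)
    then show ?thesis by (simp add: prob_space)
  qed
  moreover have "cmod (LINT y|m. \<phi> y * cnj (\<gamma> y)) \<le> e" if "0 < e" for e
  proof -
    note ev = uniform[OF that]
    obtain k where k: "\<And>y. cmod (g k y - \<phi> y) \<le> e"
      using eventually_happens'[OF F(1) ev] by blast
    have "(LINT y|m. \<phi> y * cnj (\<gamma> y)) = (LINT y|m. \<phi> y * cnj (\<gamma> y)) - (LINT y|m. g k y * cnj (\<gamma> y))"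
      by (simp add: g_coeff)
    also have "\<dots> = (LINT y|m. (\<phi> y - g k y) * cnj (\<gamma> y))"
      unfolding left_diff_distrib by (intro Bochner_Integration.integral_diff[symmetric]
          continuous_integrable continuous_intros \<phi>_cont g_cont \<gamma>_cont)
    also have "cmod \<dots> \<le> (LINT y|m. e)"
      by (intro order_trans[OF integral_norm_bound] integral_mono continuous_integrable continuous_intros
          \<phi>_cont g_cont \<gamma>_cont) (simp add: norm_mult \<gamma>_norm, subst norm_minus_commute, rule k)
    finally show ?thesis by (simp add: prob_space)
  qed
  then have "cmod (LINT y|m. \<phi> y * cnj (\<gamma> y)) \<le> 0" by (rule field_le_epsilon) simp
  ultimately have "\<phi> z0 * \<gamma> (- z0) = 0" by simp
  then show False using z0 \<gamma>_norm[of "- z0"] by auto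
qed

end

section \<open>Complex Stone--Weierstrass approximation\<close>

inductive_set complex_lin_span :: "('a \<Rightarrow> complex) set \<Rightarrow> ('a \<Rightarrow> complex) set"
  for A :: "('a \<Rightarrow> complex) set" where
  base: "a \<in> A \<Longrightarrow> (\<lambda>x. c * a x) \<in> complex_lin_span A"
| add: "h \<in> complex_lin_span A \<Longrightarrow> k \<in> complex_lin_span A \<Longrightarrow> (\<lambda>x. h x + k x) \<in> complex_lin_span A"

lemma complex_lin_span_scale:
  assumes "h \<in> complex_lin_span A" shows "(\<lambda>x. c * h x) \<in> complex_lin_span A"
  using assms
proof induction
  case (base a d)
  then show ?case using complex_lin_span.base[of a A "c * d"] by (simp add: mult.assoc)
next
  case (add h k)
  then show ?case using complex_lin_span.add by (simp add: distrib_left)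
qed

lemma complex_lin_span_mult:
  assumes A: "\<And>a b. a \<in> A \<Longrightarrow> b \<in> A \<Longrightarrow> (\<lambda>x. a x * b x) \<in> A"
    and "h \<in> complex_lin_span A" "k \<in> complex_lin_span A"
  shows "(\<lambda>x. h x * k x) \<in> complex_lin_span A"
  using assms(2)
proof induction
  case (base a c)
  note a = this
  from assms(3) show ?case
  proof induction
    case (base b d)
    then show ?case using complex_lin_span.base[OF A[OF a base], of "c * d"] by (simp add: ac_simps)
  next
    case (add h k)
    then show ?case using complex_lin_span.add by (simp add: distrib_left)
  qed
next
  case (add h k)
  then show ?case using complex_lin_span.add by (simp add: distrib_right)
qed

text \<open>
  The real-valued functions in the complex span form an algebra to which the real Stone--Weierstrass
  theorem applies: closure under conjugation puts the real and imaginary parts of the functions of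
  \<open>A\<close> into it.
\<close>
lemma Stone_Weierstrass_complex:
  fixes A :: "('a::t2_space \<Rightarrow> complex) set" and f :: "'a \<Rightarrow> complex"
  assumes K: "compact K" and cont: "\<And>a. a \<in> A \<Longrightarrow> continuous_on K a"
    and one: "(\<lambda>x. 1) \<in> A"
    and mult: "\<And>a b. a \<in> A \<Longrightarrow> b \<in> A \<Longrightarrow> (\<lambda>x. a x * b x) \<in> A"
    and cnj: "\<And>a. a \<in> A \<Longrightarrow> (\<lambda>x. cnj (a x)) \<in> A"
    and sep: "\<And>x y. x \<in> K \<Longrightarrow> y \<in> K \<Longrightarrow> x \<noteq> y \<Longrightarrow> \<exists>a\<in>A. a x \<noteq> a y"
    and f: "continuous_on K f" and e: "0 < e"
  obtains h where "h \<in> complex_lin_span A" "\<And>x. x \<in> K \<Longrightarrow> cmod (f x - h x) < e"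
proof -
  let ?V = "complex_lin_span A"
  let ?R = "{u. (\<lambda>x. complex_of_real (u x)) \<in> ?V}"
  have span_cont: "continuous_on K h" if "h \<in> ?V" for h
    using that
  proof induction
    case (base a c)
    then show ?case by (intro continuous_intros cont)
  next
    case (add h k)
    show ?case by (intro continuous_on_add add.IH)
  qed
  have Re_mem: "(\<lambda>x. Re (c * a x)) \<in> ?R" if "a \<in> A" for a c
  proof -
    have "(\<lambda>x. c / 2 * a x + cnj c / 2 * cnj (a x)) \<in> ?V"
      by (intro complex_lin_span.intros that cnj)
    moreover have "c / 2 * a x + cnj c / 2 * cnj (a x) = complex_of_real (Re (c * a x))" for x
      using complex_add_cnj[of "c * a x"] by (simp add: field_simps)
    ultimately show ?thesis by simp
  qed
  interpret function_ring_on ?R K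
  proof
    show "compact K" by (rule K)
    show "continuous_on K u" if "u \<in> ?R" for u
      using continuous_on_Re[OF span_cont[of "\<lambda>x. complex_of_real (u x)"]] that by simp
    show "(\<lambda>x. u x + v x) \<in> ?R" if "u \<in> ?R" "v \<in> ?R" for u v
      using that by (auto dest: complex_lin_span.add)
    show "(\<lambda>x. u x * v x) \<in> ?R" if "u \<in> ?R" "v \<in> ?R" for u v
    proof -
      have "(\<lambda>x. complex_of_real (u x) * complex_of_real (v x)) \<in> ?V"
        by (rule complex_lin_span_mult[OF mult]) (use that in auto)
      then show ?thesis by simp
    qed
    show "(\<lambda>_. c) \<in> ?R" for c
      using complex_lin_span.base[OF one, of "complex_of_real c"] by simp
    show "\<exists>u\<in>?R. u x \<noteq> u y" if xy: "x \<in> K" "y \<in> K" "x \<noteq> y" for x y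
    proof -
      obtain a where a: "a \<in> A" "a x \<noteq> a y" using sep[OF xy] by blast
      then have "Re (1 * a x) \<noteq> Re (1 * a y) \<or> Re (- \<i> * a x) \<noteq> Re (- \<i> * a y)"
        by (simp add: complex_eq_iff)
      then show ?thesis
      proof
        assume "Re (1 * a x) \<noteq> Re (1 * a y)"
        then show ?thesis by (rule bexI[OF _ Re_mem[OF a(1)]])
      next
        assume "Re (- \<i> * a x) \<noteq> Re (- \<i> * a y)"
        then show ?thesis by (rule bexI[OF _ Re_mem[OF a(1)]])
      qed
    qed
  qed
  have e2: "0 < e / 2" using e by simp
  have approx: "\<exists>u\<in>?R. \<forall>x\<in>K. \<bar>g x - u x\<bar> < e / 2" if "continuous_on K g" for g
    using Stone_Weierstrass_basic[OF that e2] .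
  obtain u where u: "u \<in> ?R" "\<And>x. x \<in> K \<Longrightarrow> \<bar>Re (f x) - u x\<bar> < e / 2"
    using approx[OF continuous_on_Re[OF f]] by blast
  obtain v where v: "v \<in> ?R" "\<And>x. x \<in> K \<Longrightarrow> \<bar>Im (f x) - v x\<bar> < e / 2"
    using approx[OF continuous_on_Im[OF f]] by blast
  have "(\<lambda>x. complex_of_real (u x) + \<i> * complex_of_real (v x)) \<in> ?V"
    using u v by (auto intro!: complex_lin_span.add complex_lin_span_scale)
  moreover have "cmod (f x - (complex_of_real (u x) + \<i> * complex_of_real (v x))) < e" if "x \<in> K" for x
    using u(2)[OF that] v(2)[OF that] cmod_le[of "f x - (complex_of_real (u x) + \<i> * complex_of_real (v x))"]
    by simp
  ultimately show thesis by (rule that)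
qed

section \<open>Complex measures determined by a separating algebra\<close>

text \<open>
  Continuous functions must approximate the indicators of closed sets. Outer regularity of closed sets
  suffices for this, and it is available both for Haar measure on a compact group that is not
  metrizable and for finite Borel measures on the infinite torus.
\<close>
definition outer_regular_on_closed :: "'a::topological_space measure \<Rightarrow> bool" where
  "outer_regular_on_closed M \<longleftrightarrow> sets M = sets borel \<and> finite_measure M \<and>
     (\<forall>C. closed C \<longrightarrow> emeasure M C = (INF U \<in> {U. open U \<and> C \<subseteq> U}. emeasure M U))"

lemma outer_regular_on_closed_approx:
  assumes M: "outer_regular_on_closed M" and C: "closed C" and e: "0 < e"
  obtains U where "open U" "C \<subseteq> U" "measure M U < measure M C + e"
proof -
  interpret finite_measure M using M by (simp add: outer_regular_on_closed_def)
  have "emeasure M C < ennreal (measure M C + e)"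
    unfolding emeasure_eq_measure using e by (intro ennreal_lessI) (auto intro: add_nonneg_pos)
  then have "(INF U \<in> {U. open U \<and> C \<subseteq> U}. emeasure M U) < ennreal (measure M C + e)"
    using M C by (simp add: outer_regular_on_closed_def)
  then obtain U where U: "open U" "C \<subseteq> U" "emeasure M U < ennreal (measure M C + e)"
    unfolding INF_less_iff by blast
  then have "measure M U < measure M C + e"
    unfolding emeasure_eq_measure by (subst (asm) ennreal_less_iff) auto
  with U show thesis by (intro that)
qed

text \<open>
  For decreasing \<open>W\<close> this makes Urysohn functions that are 1 on \<open>C\<close> and 0 outside \<open>W n\<close> converge
  almost everywhere to the indicator of \<open>C\<close>.
\<close>
lemma outer_regular_on_closed_null_diff:
  assumes M: "outer_regular_on_closed M" and C: "closed C"
    and W: "\<And>n. open (W n)" "\<And>n. C \<subseteq> W n" "\<And>n. measure M (W n) < measure M C + 1 / real (Suc n)"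
  shows "AE x in M. x \<in> (\<Inter>n. W n) \<longrightarrow> x \<in> C"
proof -
  interpret finite_measure M using M by (simp add: outer_regular_on_closed_def)
  have sets: "sets M = sets borel" using M by (simp add: outer_regular_on_closed_def)
  have mW: "W n \<in> sets M" for n using W(1) sets by simp
  have mI: "(\<Inter>n. W n) \<in> sets M" using mW by auto
  have mC: "C \<in> sets M" using C sets by simp
  have "measure M ((\<Inter>n. W n) - C) \<le> 1 / real (Suc n)" for n
  proof -
    have "measure M ((\<Inter>n. W n) - C) \<le> measure M (W n - C)"
      by (rule finite_measure_mono) (use mW mC in auto)
    also have "\<dots> = measure M (W n) - measure M C"
      using W(2) mW mC by (intro finite_measure_Diff) auto
    finally show ?thesis using W(3)[of n] by simp
  qed
  then have "measure M ((\<Inter>n. W n) - C) \<le> 0"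
    using LIMSEQ_le_const[OF lim_1_over_n[THEN LIMSEQ_Suc], of "measure M ((\<Inter>n. W n) - C)"] by auto
  then have "emeasure M ((\<Inter>n. W n) - C) = 0"
    unfolding emeasure_eq_measure by (simp add: antisym)
  then have "(\<Inter>n. W n) - C \<in> null_sets M" using mI mC by auto
  then show ?thesis by (auto dest!: AE_not_in)
qed

lemma integrable_mult_continuous:
  fixes f a :: "'a::topological_space \<Rightarrow> complex"
  assumes f: "integrable M f" and sets: "sets M = sets borel"
    and K: "compact K" "AE x in M. x \<in> K" and a: "continuous_on UNIV a"
  shows "integrable M (\<lambda>x. a x * f x)"
proof -
  have "bounded (a ` K)"
    using K(1) a by (intro compact_imp_bounded compact_continuous_image) (auto intro: continuous_on_subset)
  then obtain b where b: "\<And>x. x \<in> K \<Longrightarrow> cmod (a x) \<le> b" by (auto simp: bounded_iff)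
  have [measurable]: "a \<in> borel_measurable M"
    using borel_measurable_continuous_onI[OF a] sets by (simp cong: measurable_cong_sets)
  have [measurable]: "f \<in> borel_measurable M" using f by simp
  show ?thesis
  proof (rule Bochner_Integration.integrable_bound)
    show "integrable M (\<lambda>x. b * cmod (f x))" using f by simp
    show "AE x in M. cmod (a x * f x) \<le> norm (b * cmod (f x))"
      using K(2)
    proof eventually_elim
      case (elim x)
      have "cmod (a x) * cmod (f x) \<le> b * cmod (f x)" using b[OF elim] by (intro mult_right_mono) auto
      also have "\<dots> \<le> \<bar>b * cmod (f x)\<bar>" by simp
      finally show ?case by (simp add: norm_mult)
    qed
  qed simp
qed

lemma test_integrals_determine_continuous_integrals:
  fixes M N :: "'a::t2_space measure" and f1 f2 :: "'a \<Rightarrow> complex"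
  assumes setsM: "sets M = sets borel" and setsN: "sets N = sets borel"
    and K: "compact K" "AE x in M. x \<in> K" "AE x in N. x \<in> K"
    and f1: "integrable M f1" and f2: "integrable N f2"
    and cont: "\<And>a. a \<in> A \<Longrightarrow> continuous_on UNIV a"
    and one: "(\<lambda>x. 1) \<in> A"
    and mult: "\<And>a b. a \<in> A \<Longrightarrow> b \<in> A \<Longrightarrow> (\<lambda>x. a x * b x) \<in> A"
    and cnj: "\<And>a. a \<in> A \<Longrightarrow> (\<lambda>x. cnj (a x)) \<in> A"
    and sep: "\<And>x y. x \<in> K \<Longrightarrow> y \<in> K \<Longrightarrow> x \<noteq> y \<Longrightarrow> \<exists>a\<in>A. a x \<noteq> a y"
    and eq: "\<And>a. a \<in> A \<Longrightarrow> (LINT x|M. a x * f1 x) = (LINT x|N. a x * f2 x)"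
    and g: "continuous_on UNIV g"
  shows "(LINT x|M. g x * f1 x) = (LINT x|N. g x * f2 x)"
proof -
  have contK: "continuous_on K a" if "a \<in> A" for a
    using cont[OF that] by (rule continuous_on_subset) simp
  have gK: "continuous_on K g" using g by (rule continuous_on_subset) simp
  have span_cont: "continuous_on UNIV h" if "h \<in> complex_lin_span A" for h
    using that
  proof induction
    case (base a c)
    then show ?case by (intro continuous_intros cont)
  next
    case (add h k)
    show ?case by (intro continuous_on_add add.IH)
  qed
  note intM = integrable_mult_continuous[OF f1 setsM K(1,2)]
  note intN = integrable_mult_continuous[OF f2 setsN K(1,3)]
  have span_eq: "(LINT x|M. h x * f1 x) = (LINT x|N. h x * f2 x)" if "h \<in> complex_lin_span A" for h
    using that
  proof induction
    case (base a c)
    then show ?case by (simp add: mult.assoc eq)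
  next
    case (add h k)
    then show ?case
      by (simp add: distrib_right intM intN span_cont)
  qed
  have close: "cmod (LINT x|L. g x * f x - h x * f x) \<le> e * (LINT x|L. cmod (f x))"
    if "\<And>x. x \<in> K \<Longrightarrow> cmod (g x - h x) < e" "h \<in> complex_lin_span A" "AE x in L. x \<in> K"
      "sets L = sets borel" "integrable L f" for h e L f
  proof -
    have i: "integrable L (\<lambda>x. g x * f x - h x * f x)"
      using that by (intro Bochner_Integration.integrable_diff integrable_mult_continuous[OF _ _ K(1)] span_cont g)
    have "cmod (LINT x|L. g x * f x - h x * f x) \<le> (LINT x|L. cmod (g x * f x - h x * f x))"
      by (rule integral_norm_bound)
    also have "\<dots> \<le> (LINT x|L. e * cmod (f x))"
    proof (rule integral_mono_AE)
      show "AE x in L. cmod (g x * f x - h x * f x) \<le> e * cmod (f x)"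
        using that(3)
      proof eventually_elim
        case (elim x)
        show ?case
          unfolding left_diff_distrib[symmetric] norm_mult
          using that(1)[OF elim] by (intro mult_right_mono) auto
      qed
    qed (use i that(5) in auto)
    finally show ?thesis by simp
  qed
  define T where "T = (LINT x|M. cmod (f1 x)) + (LINT x|N. cmod (f2 x))"
  have T: "0 \<le> T" unfolding T_def by (intro add_nonneg_nonneg) simp_all
  have "cmod ((LINT x|M. g x * f1 x) - (LINT x|N. g x * f2 x)) \<le> e" if "0 < e" for e
  proof -
    have e': "0 < e / (T + 1)" using that T by simp
    obtain h where h: "h \<in> complex_lin_span A" "\<And>x. x \<in> K \<Longrightarrow> cmod (g x - h x) < e / (T + 1)"
      using Stone_Weierstrass_complex[OF K(1) contK one mult cnj sep gK e'] by blast
    have "(LINT x|M. g x * f1 x) - (LINT x|N. g x * f2 x)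
        = (LINT x|M. g x * f1 x - h x * f1 x) - (LINT x|N. g x * f2 x - h x * f2 x)"
      using span_eq[OF h(1)] by (simp add: intM intN g span_cont[OF h(1)])
    also have "cmod \<dots> \<le> e / (T + 1) * (LINT x|M. cmod (f1 x)) + e / (T + 1) * (LINT x|N. cmod (f2 x))"
      by (intro order_trans[OF norm_triangle_ineq4] add_mono close h K setsM setsN f1 f2)
    also have "\<dots> = e / (T + 1) * T" by (simp add: T_def distrib_left)
    also have "\<dots> \<le> e" using that T by (simp add: field_simps)
    finally show ?thesis .
  qed
  then have "cmod ((LINT x|M. g x * f1 x) - (LINT x|N. g x * f2 x)) \<le> 0"
    by (rule field_le_epsilon) simp
  then show ?thesis by simp
qed

text \<open>
  Two complex measures \<open>f1 M\<close> and \<open>f2 N\<close> are compared rather than one with zero. The case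
  \<open>f1 = f2 = 1\<close> identifies two measures by their moments, and the case \<open>f2 = 0\<close> is a
  uniqueness theorem for coefficients; both are used below. Equality passes from test functions to
  continuous functions by Stone--Weierstrass, to closed sets by Urysohn functions, and to Borel sets by
  Dynkin's argument.
\<close>
theorem test_integrals_determine_set_integrals:
  fixes M N :: "'a::t2_space measure" and f1 f2 :: "'a \<Rightarrow> complex"
  assumes normal: "normal_space (euclidean :: 'a topology)"
    and M: "outer_regular_on_closed M" and N: "outer_regular_on_closed N"
    and K: "compact K" "AE x in M. x \<in> K" "AE x in N. x \<in> K"
    and f1: "integrable M f1" and f2: "integrable N f2"
    and cont: "\<And>a. a \<in> A \<Longrightarrow> continuous_on UNIV a"
    and one: "(\<lambda>x. 1) \<in> A"
    and mult: "\<And>a b. a \<in> A \<Longrightarrow> b \<in> A \<Longrightarrow> (\<lambda>x. a x * b x) \<in> A"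
    and cnj: "\<And>a. a \<in> A \<Longrightarrow> (\<lambda>x. cnj (a x)) \<in> A"
    and sep: "\<And>x y. x \<in> K \<Longrightarrow> y \<in> K \<Longrightarrow> x \<noteq> y \<Longrightarrow> \<exists>a\<in>A. a x \<noteq> a y"
    and eq: "\<And>a. a \<in> A \<Longrightarrow> (LINT x|M. a x * f1 x) = (LINT x|N. a x * f2 x)"
    and B: "B \<in> sets borel"
  shows "(LINT x:B|M. f1 x) = (LINT x:B|N. f2 x)"
proof -
  have setsM: "sets M = sets borel" and setsN: "sets N = sets borel"
    using M N by (auto simp: outer_regular_on_closed_def)
  have spM: "space M = UNIV" "space N = UNIV"
    using sets_eq_imp_space_eq[OF setsM] sets_eq_imp_space_eq[OF setsN] by auto
  note cont_eq = test_integrals_determine_continuous_integrals[OF setsM setsN K f1 f2 cont one mult cnj sep eq]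
  have closed_eq: "(LINT x:C|M. f1 x) = (LINT x:C|N. f2 x)" if C: "closed C" for C
  proof -
    have "\<exists>U. open U \<and> C \<subseteq> U \<and> measure M U < measure M C + 1 / real (Suc n) \<and> measure N U < measure N C + 1 / real (Suc n)" for n
    proof -
      have n0: "0 < 1 / real (Suc n)" by simp
      obtain U where U: "open U" "C \<subseteq> U" "measure M U < measure M C + 1 / real (Suc n)"
        using outer_regular_on_closed_approx[OF M C n0] .
      obtain V where V: "open V" "C \<subseteq> V" "measure N V < measure N C + 1 / real (Suc n)"
        using outer_regular_on_closed_approx[OF N C n0] .
      interpret M: finite_measure M using M by (simp add: outer_regular_on_closed_def)
      interpret N: finite_measure N using N by (simp add: outer_regular_on_closed_def)
      have "measure M (U \<inter> V) \<le> measure M U" "measure N (U \<inter> V) \<le> measure N V"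
        using U V setsM setsN by (auto intro!: M.finite_measure_mono N.finite_measure_mono)
      then show ?thesis using U V by (intro exI[of _ "U \<inter> V"]) auto
    qed
    then obtain U where U: "\<And>n. open (U n)" "\<And>n. C \<subseteq> U n"
      and UM: "\<And>n. measure M (U n) < measure M C + 1 / real (Suc n)"
      and UN: "\<And>n. measure N (U n) < measure N C + 1 / real (Suc n)"
      by metis
    \<comment> \<open>A decreasing version of \<open>U\<close>: a point outside one \<open>U n\<close> must lie outside all later supports.\<close>
    define W where "W n = (\<Inter>i\<le>n. U i)" for n
    have W: "open (W n)" "C \<subseteq> W n" for n using U by (auto simp: W_def)
    have nullM: "AE x in M. x \<in> (\<Inter>n. U n) \<longrightarrow> x \<in> C" and nullN: "AE x in N. x \<in> (\<Inter>n. U n) \<longrightarrow> x \<in> C"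
      using outer_regular_on_closed_null_diff[OF M C U UM] outer_regular_on_closed_null_diff[OF N C U UN] .
    have "\<exists>g::'a \<Rightarrow> real. continuous_on UNIV g \<and> range g \<subseteq> {0..1} \<and> (\<forall>x. x \<notin> W n \<longrightarrow> g x = 0) \<and> (\<forall>x\<in>C. g x = 1)" for n
    proof -
      have "closedin euclidean (- W n)" "closedin euclidean C" "disjnt (- W n) C"
        using W C by (auto simp: disjnt_def)
      from Urysohn_lemma[OF normal this, of 0 1] obtain g
        where "continuous_map euclidean (top_of_set {0..1::real}) g" "g ` (- W n) \<subseteq> {0}" "g ` C \<subseteq> {1}"
        by auto
      then show ?thesis
        by (intro exI[of _ g]) (auto simp: continuous_map_in_subtopology image_subset_iff)
    qed
    then obtain g :: "nat \<Rightarrow> 'a \<Rightarrow> real" where g: "\<And>n. continuous_on UNIV (g n)" "\<And>n. range (g n) \<subseteq> {0..1}"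
      "\<And>n x. x \<notin> W n \<Longrightarrow> g n x = 0" "\<And>n x. x \<in> C \<Longrightarrow> g n x = 1"
      by metis
    have g_lim: "(\<lambda>n. g n x) \<longlonglongrightarrow> indicat_real C x" if x: "x \<in> (\<Inter>n. U n) \<longrightarrow> x \<in> C" for x
    proof (cases "x \<in> C")
      case True
      then show ?thesis by (simp add: g(4))
    next
      case False
      then obtain n where "x \<notin> U n" using x by blast
      then have "g k x = 0" if "n \<le> k" for k using that by (intro g(3)) (auto simp: W_def)
      then have "\<forall>\<^sub>F k in sequentially. g k x = 0" by (auto simp: eventually_sequentially)
      then show ?thesis using False by (simp add: tendsto_eventually)
    qed
    have conv: "(\<lambda>n. LINT x|L. complex_of_real (g n x) * f x) \<longlonglongrightarrow> (LINT x:C|L. f x)"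
      if "sets L = sets borel" "integrable L f" "AE x in L. x \<in> (\<Inter>n. U n) \<longrightarrow> x \<in> C" for L f
      unfolding set_lebesgue_integral_def
    proof (rule integral_dominated_convergence)
      have [measurable]: "f \<in> borel_measurable L" "g n \<in> borel_measurable L" "C \<in> sets L" for n
        using that borel_measurable_continuous_onI[OF g(1)] C by (auto cong: measurable_cong_sets)
      show "(\<lambda>x. indicat_real C x *\<^sub>R f x) \<in> borel_measurable L" by measurable
      show "(\<lambda>x. complex_of_real (g n x) * f x) \<in> borel_measurable L" for n by measurable
      show "integrable L (\<lambda>x. cmod (f x))" using that by simp
      show "AE x in L. (\<lambda>n. complex_of_real (g n x) * f x) \<longlonglongrightarrow> indicat_real C x *\<^sub>R f x"
        using that(3) by eventually_elim (auto simp: scaleR_conv_of_real intro!: tendsto_mult tendsto_of_real g_lim)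
      have "\<bar>g n x\<bar> \<le> 1" for n x using g(2)[of n] by (auto simp: image_subset_iff)
      then show "AE x in L. cmod (complex_of_real (g n x) * f x) \<le> cmod (f x)" for n
        by (auto simp: norm_mult mult_left_le_one_le)
    qed
    have "(LINT x|M. complex_of_real (g n x) * f1 x) = (LINT x|N. complex_of_real (g n x) * f2 x)" for n
      by (intro cont_eq continuous_on_of_real g)
    then show ?thesis
      using LIMSEQ_unique[OF conv[OF setsM f1 nullM]] conv[OF setsN f2 nullN] by simp
  qed
  have setint: "set_integrable M X f1" "set_integrable N X f2" if "X \<in> sets borel" for X
    unfolding set_integrable_def using that setsM setsN f1 f2 by (auto intro!: integrable_mult_indicator)
  have all: "(LINT x:UNIV|M. f1 x) = (LINT x:UNIV|N. f2 x)" by (rule closed_eq) simp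
  have borel: "sigma_sets UNIV (Collect closed) = sets (borel :: 'a measure)"
    unfolding borel_eq_closed by simp
  have "Int_stable (Collect closed :: 'a set set)" by (auto simp: Int_stable_def)
  moreover have "Collect closed \<subseteq> Pow (UNIV :: 'a set)" by simp
  moreover from B have "B \<in> sigma_sets UNIV (Collect closed)" unfolding borel .
  ultimately show ?thesis
  proof (induction rule: sigma_sets_induct_disjoint)
    case (basic C)
    then show ?case using closed_eq by simp
  next
    case empty
    then show ?case by (simp add: set_lebesgue_integral_def)
  next
    case (compl X)
    then have X: "X \<in> sets borel" by (simp add: borel)
    have "(LINT x:UNIV|M. f1 x) = (LINT x:X|M. f1 x) + (LINT x:UNIV - X|M. f1 x)"
      "(LINT x:UNIV|N. f2 x) = (LINT x:X|N. f2 x) + (LINT x:UNIV - X|N. f2 x)"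
      using X setint[of X] setint[of "UNIV - X"] by (subst set_integral_Un[symmetric]; auto)+
    then show ?case using all compl by simp
  next
    case (union X)
    then have X: "X i \<in> sets borel" for i by (auto simp: borel)
    have dis: "X i \<inter> X j = {}" if "i \<noteq> j" for i j
      using union(1) that by (auto simp: disjoint_family_on_def)
    have "(LINT x:(\<Union>i. X i)|M. f1 x) = (\<Sum>i. LINT x:X i|M. f1 x)"
      using X setsM by (intro lebesgue_integral_countable_add dis setint) auto
    moreover have "(LINT x:(\<Union>i. X i)|N. f2 x) = (\<Sum>i. LINT x:X i|N. f2 x)"
      using X setsN by (intro lebesgue_integral_countable_add dis setint) auto
    ultimately show ?case using union by simp
  qed
qed

section \<open>Monomials on the infinite torus\<close>

text \<open>
  The trigonometric monomials on the infinite torus. Generating them as functions, instead of indexing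
  them by exponent vectors, lets facts such as being a character after composition with characters in
  each coordinate be proved by induction.
\<close>
inductive_set torus_monomials :: "((nat \<Rightarrow> complex) \<Rightarrow> complex) set" where
  one: "(\<lambda>z. 1) \<in> torus_monomials"
| coord: "q \<in> torus_monomials \<Longrightarrow> (\<lambda>z. z n * q z) \<in> torus_monomials"
| cnj_coord: "q \<in> torus_monomials \<Longrightarrow> (\<lambda>z. cnj (z n) * q z) \<in> torus_monomials"

lemma torus_monomials_mult:
  assumes "q \<in> torus_monomials" "r \<in> torus_monomials"
  shows "(\<lambda>z. q z * r z) \<in> torus_monomials"
  using assms(1) by induction (auto simp: mult.assoc assms intro: torus_monomials.intros)

lemma torus_monomials_cnj:
  assumes "q \<in> torus_monomials" shows "(\<lambda>z. cnj (q z)) \<in> torus_monomials"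
  using assms by induction (auto intro: torus_monomials.intros)

lemma torus_monomials_continuous:
  assumes "q \<in> torus_monomials" shows "continuous_on UNIV q"
  using assms
proof induction
  case one
  show ?case by (rule continuous_on_const)
next
  case (coord q n)
  show ?case by (intro continuous_on_mult coord continuous_on_product_coordinates)
next
  case (cnj_coord q n)
  show ?case by (intro continuous_on_mult continuous_on_cnj cnj_coord continuous_on_product_coordinates)
qed

definition infinite_torus :: "(nat \<Rightarrow> complex) set" where
  "infinite_torus = {z. \<forall>n. cmod (z n) = 1}"

lemma compact_infinite_torus: "compact infinite_torus"
proof -
  have "compact (PiE UNIV (\<lambda>_::nat. sphere (0::complex) 1))"
    unfolding compactin_euclidean_iff[symmetric] euclidean_product_topology[symmetric] compactin_PiE by simp
  then show ?thesis by (simp add: PiE_UNIV_domain Pi_def infinite_torus_def)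
qed

lemma torus_monomials_separate:
  fixes x y :: "nat \<Rightarrow> complex"
  assumes "x \<noteq> y" shows "\<exists>q\<in>torus_monomials. q x \<noteq> q y"
proof -
  obtain n where "x n \<noteq> y n" using assms by blast
  then show ?thesis by (intro bexI[OF _ torus_monomials.coord[OF torus_monomials.one, of n]]) simp
qed

lemma outer_regular_on_closed_polish:
  fixes M :: "'a::polish_space measure"
  assumes "sets M = sets borel" "finite_measure M"
  shows "outer_regular_on_closed M"
  unfolding outer_regular_on_closed_def
proof (intro conjI allI impI assms)
  fix C :: "'a set" assume "closed C"
  then have "emeasure M C = (INF U \<in> {U. C \<subseteq> U \<and> open U}. emeasure M U)"
    using assms by (intro outer_regular) (auto simp: finite_measure.emeasure_finite)
  then show "emeasure M C = (INF U \<in> {U. open U \<and> C \<subseteq> U}. emeasure M U)" by (simp add: conj_commute)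
qed

lemma torus_measures_eqI:
  fixes M N :: "(nat \<Rightarrow> complex) measure"
  assumes M: "sets M = sets borel" "finite_measure M" "AE z in M. z \<in> infinite_torus"
    and N: "sets N = sets borel" "finite_measure N" "AE z in N. z \<in> infinite_torus"
    and eq: "\<And>q. q \<in> torus_monomials \<Longrightarrow> (LINT z|M. q z) = (LINT z|N. q z)"
  shows "M = N"
proof (rule measure_eqI)
  show "sets M = sets N" using M N by simp
next
  fix B assume "B \<in> sets M"
  then have B: "B \<in> sets borel" using M by simp
  interpret M: finite_measure M by fact
  interpret N: finite_measure N by fact
  have "(LINT z:B|M. (1::complex)) = (LINT z:B|N. 1)"
  proof (rule test_integrals_determine_set_integrals[where K = infinite_torus and A = torus_monomials])
    show "normal_space (euclidean :: (nat \<Rightarrow> complex) topology)"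
      by (rule metrizable_imp_normal_space[OF metrizable_space_euclidean])
    show "outer_regular_on_closed M" "outer_regular_on_closed N"
      using M N by (auto intro: outer_regular_on_closed_polish)
  qed (use M N B eq in \<open>auto intro: compact_infinite_torus torus_monomials_continuous torus_monomials.one
      torus_monomials_mult torus_monomials_cnj torus_monomials_separate\<close>)
  then have "complex_of_real (measure M B) = complex_of_real (measure N B)"
    using B M(1) N(1) by (simp add: set_lebesgue_integral_def scaleR_conv_of_real)
  then show "emeasure M B = emeasure N B"
    by (simp add: M.emeasure_eq_measure N.emeasure_eq_measure)
qed

lemma torus_monomial_coefficients_zero:
  fixes M :: "(nat \<Rightarrow> complex) measure" and f :: "(nat \<Rightarrow> complex) \<Rightarrow> complex"
  assumes M: "sets M = sets borel" "finite_measure M" "AE z in M. z \<in> infinite_torus"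
    and f: "integrable M f" and eq: "\<And>q. q \<in> torus_monomials \<Longrightarrow> (LINT z|M. q z * f z) = 0"
  shows "AE z in M. f z = 0"
proof -
  interpret finite_measure M by fact
  show ?thesis
  proof (rule density_zero[OF f])
    fix B assume "B \<in> sets M"
    then have B: "B \<in> sets borel" using M by simp
    have "(LINT z:B|M. f z) = (LINT z:B|M. 0)"
    proof (rule test_integrals_determine_set_integrals[where K = infinite_torus and A = torus_monomials])
      show "normal_space (euclidean :: (nat \<Rightarrow> complex) topology)"
        by (rule metrizable_imp_normal_space[OF metrizable_space_euclidean])
      show "outer_regular_on_closed M" "outer_regular_on_closed M"
        using M by (auto intro: outer_regular_on_closed_polish)
    qed (use M B f eq in \<open>auto intro: compact_infinite_torus torus_monomials_continuous torus_monomials.one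
        torus_monomials_mult torus_monomials_cnj torus_monomials_separate\<close>)
    then show "(LINT z:B|M. f z) = 0" by (simp add: set_lebesgue_integral_def)
  qed
qed

section \<open>Uniqueness of Fourier coefficients\<close>

context dirichlet_haar begin

lemma compact_normal: "normal_space (euclidean :: 'g topology)"
proof (rule compact_Hausdorff_or_regular_imp_normal_space)
  show "compact_space (euclidean :: 'g topology)" using compact_UNIV by (simp add: compact_space_def)
  show "Hausdorff_space (euclidean :: 'g topology) \<or> regular_space (euclidean :: 'g topology)"
    by (rule disjI1) (simp add: Hausdorff_space_def disjnt_def, metis hausdorff)
qed

lemma haar_outer_regular: "outer_regular_on_closed m"
  unfolding outer_regular_on_closed_def
proof (intro conjI allI impI sets_m finite_measure_axioms)
  fix C :: "'g set" assume "closed C"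
  then have "C \<in> sets borel" by simp
  then show "emeasure m C = (INF U \<in> {U. open U \<and> C \<subseteq> U}. emeasure m U)"
    using haar unfolding normalized_haar_def by blast
qed

lemma character_mult: "\<gamma> \<in> characters \<Longrightarrow> \<eta> \<in> characters \<Longrightarrow> (\<lambda>x. \<gamma> x * \<eta> x) \<in> characters"
  and character_cnj: "\<gamma> \<in> characters \<Longrightarrow> (\<lambda>x. cnj (\<gamma> x)) \<in> characters"
  and character_one: "(\<lambda>x. 1) \<in> characters"
  for \<gamma> \<eta> :: "'g \<Rightarrow> complex"
  by (auto simp: characters_def norm_mult intro!: continuous_intros)

lemma character_continuous: "\<gamma> \<in> characters \<Longrightarrow> continuous_on UNIV \<gamma>" for \<gamma> :: "'g \<Rightarrow> complex"
  by (simp add: characters_def)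

text \<open>
  If all characters agree at \<open>x\<close> and \<open>y\<close>, then the translates of any continuous function by \<open>x\<close>
  and by \<open>y\<close> have the same Fourier coefficients, hence coincide, which is false for a Urysohn
  function.
\<close>
lemma characters_separate:
  fixes x y :: 'g
  assumes "x \<noteq> y" shows "\<exists>\<gamma>\<in>characters. \<gamma> x \<noteq> \<gamma> y"
proof (rule ccontr)
  assume "\<not> ?thesis"
  then have eq: "\<gamma> x = \<gamma> y" if "\<gamma> \<in> characters" for \<gamma> :: "'g \<Rightarrow> complex" using that by blast
  have "closedin euclidean {x}" "closedin euclidean {y}" "disjnt {x} {y}"
    using assms by (auto simp: disjnt_def)
  from Urysohn_lemma[OF compact_normal this, of 0 1] obtain u
    where u: "continuous_map euclidean (top_of_set {0..1::real}) u" "u ` {x} \<subseteq> {0}" "u ` {y} \<subseteq> {1}"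
    by auto
  have u_cont: "continuous_on UNIV (\<lambda>w. complex_of_real (u w))"
    using u(1) by (intro continuous_intros) (simp add: continuous_map_in_subtopology)
  define f where "f w = complex_of_real (u (w + x)) - complex_of_real (u (w + y))" for w
  have f_cont: "continuous_on UNIV f"
    unfolding f_def by (intro continuous_intros continuous_translate[OF u_cont])
  have "fourier_coeff m f \<gamma> = 0" if \<gamma>: "\<gamma> \<in> characters" for \<gamma>
  proof -
    have \<gamma>_cont: "continuous_on UNIV \<gamma>" and \<gamma>_add: "\<And>x y. \<gamma> (x + y) = \<gamma> x * \<gamma> y"
      and \<gamma>_norm: "\<And>x. cmod (\<gamma> x) = 1" using \<gamma> by (auto simp: characters_def)
    have sq: "cnj (\<gamma> w) = \<gamma> a * cnj (\<gamma> (w + a))" for w a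
      using complex_norm_square[of "\<gamma> a"] by (simp add: \<gamma>_add \<gamma>_norm)
    have tr: "(LINT w|m. u (w + a) * cnj (\<gamma> w)) = \<gamma> a * (LINT w|m. u w * cnj (\<gamma> w))" for a
    proof -
      have "(LINT w|m. u (w + a) * cnj (\<gamma> w)) = (LINT w|m. \<gamma> a * (u (w + a) * cnj (\<gamma> (w + a))))"
        by (intro Bochner_Integration.integral_cong refl, subst sq[of _ a]) simp
      also have "\<dots> = \<gamma> a * (LINT w|m. u (w + a) * cnj (\<gamma> (w + a)))" by simp
      also have "(LINT w|m. u (w + a) * cnj (\<gamma> (w + a))) = (LINT w|m. u w * cnj (\<gamma> w))"
        by (rule integral_translate) (intro continuous_measurable continuous_on_mult continuous_on_cnj u_cont \<gamma>_cont)
      finally show ?thesis .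
    qed
    have i: "integrable m (\<lambda>w. complex_of_real (u (w + a)) * cnj (\<gamma> w))" for a
      by (intro continuous_integrable continuous_on_mult continuous_on_cnj continuous_translate[OF u_cont] \<gamma>_cont)
    have "fourier_coeff m f \<gamma> = (LINT w|m. u (w + x) * cnj (\<gamma> w)) - (LINT w|m. u (w + y) * cnj (\<gamma> w))"
      unfolding fourier_coeff_def f_def left_diff_distrib by (rule Bochner_Integration.integral_diff[OF i i])
    then show ?thesis unfolding tr using eq[OF \<gamma>] by simp
  qed
  then have "f 0 = 0" by (rule fourier_coeff_zero_imp_zero_continuous[OF f_cont])
  then show False using u by (simp add: f_def)
qed

text \<open>
  The characters are closed under products and conjugation and separate points, so vanishing
  coefficients force the integrals of \<open>f\<close> over all Borel sets to vanish.
\<close>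
theorem fourier_coeff_zero_imp_zero:
  assumes f: "integrable m f" and coeff: "\<And>\<gamma>. \<gamma> \<in> characters \<Longrightarrow> fourier_coeff m f \<gamma> = 0"
  shows "AE x in m. f x = 0"
proof (rule density_zero[OF f])
  fix B assume "B \<in> sets m"
  then have B: "B \<in> sets borel" using sets_m by simp
  have "(LINT z:B|m. f z) = (LINT z:B|m. 0)"
  proof (rule test_integrals_determine_set_integrals[where K = UNIV and A = characters])
    show "(LINT x|m. a x * f x) = (LINT x|m. a x * 0)" if "a \<in> characters" for a
      using coeff[OF character_cnj[OF that]] by (simp add: fourier_coeff_def mult.commute)
  qed (use B f in \<open>auto intro: compact_UNIV compact_normal haar_outer_regular character_continuous character_one
      character_mult character_cnj characters_separate\<close>)
  then show "(LINT z:B|m. f z) = 0" by (simp add: set_lebesgue_integral_def)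
qed

text \<open>
  Translation by \<open>a\<close> multiplies the integral by \<open>\<gamma> a\<close> and leaves it unchanged.
\<close>
lemma integral_character:
  assumes \<gamma>: "\<gamma> \<in> characters"
  shows "(LINT x|m. \<gamma> x) = (if \<gamma> = (\<lambda>x. 1) then 1 else 0)"
proof (cases "\<gamma> = (\<lambda>x. 1)")
  case True
  then show ?thesis by (simp add: prob_space)
next
  case False
  then obtain a where a: "\<gamma> a \<noteq> 1" by blast
  have "(LINT x|m. \<gamma> x) = (LINT x|m. \<gamma> (x + a))"
    by (rule integral_translate[symmetric]) (intro continuous_measurable character_continuous \<gamma>)
  also have "\<dots> = (LINT x|m. \<gamma> x) * \<gamma> a" using \<gamma> by (simp add: characters_def)
  finally show ?thesis using a False by simp
qed

end

section \<open>Projecting densities along a map\<close>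

text \<open>
  The image of the measure $f\,dM$ is absolutely continuous with respect to the image of $M$; $D$ is
  its Radon--Nikodym derivative. Thus $D \circ \Phi$ is the conditional expectation of $f$ given
  $\Phi$, already written as a function of $\Phi$.
\<close>
lemma pushforward_density_nonneg:
  fixes f :: "'a \<Rightarrow> real"
  assumes M: "finite_measure M" and \<Phi>: "\<Phi> \<in> measurable M X" and f: "integrable M f" "\<And>x. 0 \<le> f x"
  obtains D :: "'b \<Rightarrow> real"
  where "D \<in> borel_measurable X"
    "\<And>k :: 'b \<Rightarrow> complex. k \<in> borel_measurable X \<Longrightarrow>
       integrable (distr M X \<Phi>) (\<lambda>y. D y *\<^sub>R k y) \<longleftrightarrow> integrable M (\<lambda>x. f x *\<^sub>R k (\<Phi> x))"
    "\<And>k :: 'b \<Rightarrow> complex. k \<in> borel_measurable X \<Longrightarrow>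
       (LINT y|distr M X \<Phi>. D y *\<^sub>R k y) = (LINT x|M. f x *\<^sub>R k (\<Phi> x))"
proof -
  let ?\<mu> = "distr M X \<Phi>"
  define N where "N = distr (density M (\<lambda>x. ennreal (f x))) X \<Phi>"
  have [measurable]: "f \<in> borel_measurable M" using f by simp
  note \<Phi>[measurable]
  have \<Phi>': "\<Phi> \<in> measurable (density M (\<lambda>x. ennreal (f x))) X" by simp
  interpret \<mu>: finite_measure ?\<mu> using finite_measure.finite_measure_distr[OF M \<Phi>] .
  have "finite_measure (density M (\<lambda>x. ennreal (f x)))"
  proof (rule finite_measureI)
    have "emeasure (density M (\<lambda>x. ennreal (f x))) (space M) = (\<integral>\<^sup>+ x. ennreal (f x) \<partial>M)"
      by (simp add: emeasure_density cong: nn_integral_cong)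
    also have "\<dots> \<noteq> \<infinity>" using f by (simp add: nn_integral_eq_integral)
    finally show "emeasure (density M (\<lambda>x. ennreal (f x))) (space (density M (\<lambda>x. ennreal (f x)))) \<noteq> \<infinity>" by simp
  qed
  then have N: "finite_measure N" unfolding N_def by (rule finite_measure.finite_measure_distr[OF _ \<Phi>'])
  have setsN: "sets N = sets ?\<mu>" by (simp add: N_def)
  have ac: "absolutely_continuous ?\<mu> N"
    unfolding absolutely_continuous_def
  proof
    fix A assume "A \<in> null_sets ?\<mu>"
    then have A: "A \<in> sets X" "\<Phi> -` A \<inter> space M \<in> null_sets M"
      by (auto simp: null_sets_distr_iff[OF \<Phi>])
    then have "AE x in M. x \<in> \<Phi> -` A \<inter> space M \<longrightarrow> ennreal (f x) = 0"
      by (intro eventually_mono[OF AE_not_in[OF A(2)]]) auto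
    then have "\<Phi> -` A \<inter> space M \<in> null_sets (density M (\<lambda>x. ennreal (f x)))"
      using A by (auto simp: null_sets_density_iff)
    then show "A \<in> null_sets N" unfolding N_def null_sets_distr_iff[OF \<Phi>'] using A by simp
  qed
  obtain D where D: "D \<in> borel_measurable ?\<mu>" "AE x in ?\<mu>. RN_deriv ?\<mu> N x = ennreal (D x)" "\<And>x. 0 \<le> D x"
    using \<mu>.real_RN_deriv[OF N ac setsN] by metis
  have DN: "density ?\<mu> (\<lambda>x. ennreal (D x)) = N"
  proof -
    have "density ?\<mu> (\<lambda>x. ennreal (D x)) = density ?\<mu> (RN_deriv ?\<mu> N)"
      using D by (intro density_cong) auto
    then show ?thesis using \<mu>.density_RN_deriv[OF ac setsN] by simp
  qed
  have [measurable]: "D \<in> borel_measurable X" using D(1) by simp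
  show thesis
  proof (rule that)
    show "D \<in> borel_measurable X" by simp
  next
    fix k :: "'b \<Rightarrow> complex" assume k[measurable]: "k \<in> borel_measurable X"
    have "integrable ?\<mu> (\<lambda>y. D y *\<^sub>R k y) \<longleftrightarrow> integrable (density ?\<mu> (\<lambda>x. ennreal (D x))) k"
      using D by (subst integrable_density) auto
    also have "\<dots> \<longleftrightarrow> integrable (density M (\<lambda>x. ennreal (f x))) (\<lambda>x. k (\<Phi> x))"
      unfolding DN N_def by (rule integrable_distr_eq[OF \<Phi>' k])
    also have "\<dots> \<longleftrightarrow> integrable M (\<lambda>x. f x *\<^sub>R k (\<Phi> x))"
      using f by (subst integrable_density) auto
    finally show "integrable ?\<mu> (\<lambda>y. D y *\<^sub>R k y) \<longleftrightarrow> integrable M (\<lambda>x. f x *\<^sub>R k (\<Phi> x))" .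
    have "(LINT y|?\<mu>. D y *\<^sub>R k y) = integral\<^sup>L (density ?\<mu> (\<lambda>x. ennreal (D x))) k"
      using D by (subst integral_density) auto
    also have "\<dots> = integral\<^sup>L (density M (\<lambda>x. ennreal (f x))) (\<lambda>x. k (\<Phi> x))"
      unfolding DN N_def by (rule integral_distr[OF \<Phi>' k])
    also have "\<dots> = (LINT x|M. f x *\<^sub>R k (\<Phi> x))"
      using f by (subst integral_density) auto
    finally show "(LINT y|?\<mu>. D y *\<^sub>R k y) = (LINT x|M. f x *\<^sub>R k (\<Phi> x))" .
  qed
qed

text \<open>
  For complex \<open>f\<close> the four parts are treated separately. The test function \<open>k\<close> is allowed to be
  unbounded as long as the product is integrable; this will be used with \<open>k\<close> integrable and \<open>f\<close> a
  character.
\<close>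
lemma pushforward_density:
  fixes f :: "'a \<Rightarrow> complex"
  assumes M: "finite_measure M" and \<Phi>: "\<Phi> \<in> measurable M X" and f: "integrable M f"
  obtains F :: "'b \<Rightarrow> complex"
  where "F \<in> borel_measurable X" "integrable (distr M X \<Phi>) F"
    "\<And>k. k \<in> borel_measurable X \<Longrightarrow> integrable M (\<lambda>x. k (\<Phi> x) * f x) \<Longrightarrow>
       integrable (distr M X \<Phi>) (\<lambda>y. k y * F y) \<and>
       (LINT y|distr M X \<Phi>. k y * F y) = (LINT x|M. k (\<Phi> x) * f x)"
proof -
  let ?\<mu> = "distr M X \<Phi>"
  note \<Phi>[measurable]
  have [measurable]: "f \<in> borel_measurable M" using f by simp
  \<comment> \<open>Positive and negative parts of the real part (\<open>0, 1\<close>) and of the imaginary part (\<open>2, 3\<close>).\<close>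
  define p where "p = (\<lambda>(i::nat) x. max 0 (if i = 0 then Re (f x) else if i = 1 then - Re (f x) else if i = 2 then Im (f x) else - Im (f x)))"
  have [measurable]: "p i \<in> borel_measurable M" for i unfolding p_def by simp
  have p0: "0 \<le> p i x" for i x by (simp add: p_def)
  have pf: "p i x \<le> cmod (f x)" for i x
    using abs_Re_le_cmod[of "f x"] abs_Im_le_cmod[of "f x"] by (auto simp: p_def max_def)
  have decomp: "f x = p 0 x - p 1 x + \<i> * (p 2 x - p 3 x)" for x
    by (auto simp: p_def complex_eq_iff max_def)
  have pint: "integrable M (p i)" for i
    by (rule Bochner_Integration.integrable_bound[OF f]) (auto simp: p0 pf)
  have "\<exists>D. D \<in> borel_measurable X \<and> (\<forall>k :: 'b \<Rightarrow> complex. k \<in> borel_measurable X \<longrightarrow>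
       (integrable ?\<mu> (\<lambda>y. D y *\<^sub>R k y) \<longleftrightarrow> integrable M (\<lambda>x. p i x *\<^sub>R k (\<Phi> x))) \<and>
       (LINT y|?\<mu>. D y *\<^sub>R k y) = (LINT x|M. p i x *\<^sub>R k (\<Phi> x)))" for i
    by (rule pushforward_density_nonneg[OF M \<Phi> pint[of i] p0]) blast
  from choice[OF allI[OF this]] obtain D where D': "\<forall>i. D i \<in> borel_measurable X \<and> (\<forall>k :: 'b \<Rightarrow> complex. k \<in> borel_measurable X \<longrightarrow>
       (integrable ?\<mu> (\<lambda>y. D i y *\<^sub>R k y) \<longleftrightarrow> integrable M (\<lambda>x. p i x *\<^sub>R k (\<Phi> x))) \<and>
       (LINT y|?\<mu>. D i y *\<^sub>R k y) = (LINT x|M. p i x *\<^sub>R k (\<Phi> x)))" ..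
  then have Dm[measurable]: "D i \<in> borel_measurable X" for i by blast
  define F where "F y = complex_of_real (D 0 y) - D 1 y + \<i> * (D 2 y - D 3 y)" for y
  have Fm: "F \<in> borel_measurable X" unfolding F_def by measurable
  have key: "integrable ?\<mu> (\<lambda>y. k y * F y) \<and> (LINT y|?\<mu>. k y * F y) = (LINT x|M. k (\<Phi> x) * f x)"
    if k[measurable]: "k \<in> borel_measurable X" and i: "integrable M (\<lambda>x. k (\<Phi> x) * f x)" for k
  proof -
    have ip: "integrable M (\<lambda>x. p i x *\<^sub>R k (\<Phi> x))" for i
    proof (rule Bochner_Integration.integrable_bound[OF i])
      show "AE x in M. cmod (p i x *\<^sub>R k (\<Phi> x)) \<le> cmod (k (\<Phi> x) * f x)"
        using pf p0 by (auto simp: norm_mult mult.commute[of "cmod (k _)"] intro!: mult_right_mono)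
    qed simp
    have iD: "integrable ?\<mu> (\<lambda>y. D i y *\<^sub>R k y)" and eD: "(LINT y|?\<mu>. D i y *\<^sub>R k y) = (LINT x|M. p i x *\<^sub>R k (\<Phi> x))" for i
      using D' k ip by blast+
    have kF: "k y * F y = D 0 y *\<^sub>R k y - D 1 y *\<^sub>R k y + \<i> * (D 2 y *\<^sub>R k y - D 3 y *\<^sub>R k y)" for y
      by (simp add: F_def scaleR_conv_of_real algebra_simps)
    have kf: "k (\<Phi> x) * f x = p 0 x *\<^sub>R k (\<Phi> x) - p 1 x *\<^sub>R k (\<Phi> x) + \<i> * (p 2 x *\<^sub>R k (\<Phi> x) - p 3 x *\<^sub>R k (\<Phi> x))" for x
      by (subst decomp) (simp add: scaleR_conv_of_real algebra_simps)
    show ?thesis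
      unfolding kF kf using iD ip eD
      by (simp add: Bochner_Integration.integral_diff Bochner_Integration.integral_add
          del: scaleR_conv_of_real)
  qed
  show thesis
  proof (rule that[OF Fm _ key])
    show "integrable ?\<mu> F" using key[of "\<lambda>_. 1"] f by simp
  qed
qed

section \<open>Integrability classes under change of function and measure\<close>

lemma Lp_imp_integrable:
  assumes M: "finite_measure M" and p: "1 \<le> p" and f: "f \<in> Lp p M"
  shows "integrable M f"
proof -
  interpret finite_measure M by fact
  have fm: "f \<in> borel_measurable M" using f by (simp add: Lp_def)
  show ?thesis
  proof (cases "p = \<infinity>")
    case True
    let ?s = "esssup M (\<lambda>x. ennreal (cmod (f x)))"
    have s: "?s < \<infinity>" using f True by (simp add: Lp_def)
    have "AE x in M. cmod (f x) \<le> enn2real ?s"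
      using esssup_AE[of "\<lambda>x. ennreal (cmod (f x))" M]
    proof eventually_elim
      case (elim x)
      then have "enn2real (ennreal (cmod (f x))) \<le> enn2real ?s"
        using s by (intro enn2real_mono) auto
      then show ?case by simp
    qed
    then show ?thesis using fm by (rule integrable_const_bound)
  next
    case False
    define r where "r = enn2real p"
    have r: "1 \<le> r"
      using enn2real_mono[OF p] False by (simp add: r_def top.not_eq_extremum)
    have i: "integrable M (\<lambda>x. 1 + cmod (f x) powr r)"
      using f False by (simp add: Lp_def r_def)
    have "cmod (f x) \<le> 1 + cmod (f x) powr r" for x
    proof (cases "cmod (f x) \<le> 1")
      case True
      then show ?thesis using powr_ge_zero[of "cmod (f x)" r] by linarith
    next
      case False
      then have "cmod (f x) powr 1 \<le> cmod (f x) powr r" using r by (intro powr_mono) auto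
      then show ?thesis using False by simp
    qed
    then show ?thesis
      by (intro Bochner_Integration.integrable_bound[OF i fm]) (auto intro: order_trans[OF _ abs_ge_self])
  qed
qed

lemma Lp_cong_AE:
  assumes f: "f \<in> borel_measurable M" and g: "g \<in> borel_measurable M" and eq: "AE x in M. f x = g x"
  shows "f \<in> Lp p M \<longleftrightarrow> g \<in> Lp p M" and "Lp_norm p M f = Lp_norm p M g"
    and "\<gamma> \<in> borel_measurable M \<Longrightarrow> fourier_coeff M f \<gamma> = fourier_coeff M g \<gamma>"
proof -
  note [measurable] = f g
  have "(AE x in M. ennreal (cmod (f x)) \<le> z) \<longleftrightarrow> (AE x in M. ennreal (cmod (g x)) \<le> z)" for z
    using eq by (intro iffI; elim AE_mp) (auto elim!: AE_mp)
  then have ess: "esssup M (\<lambda>x. ennreal (cmod (f x))) = esssup M (\<lambda>x. ennreal (cmod (g x)))"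
    by (subst (1 2) esssup_eq_AE) auto
  have pow: "AE x in M. cmod (f x) powr r = cmod (g x) powr r" for r
    using eq by eventually_elim simp
  have int: "integrable M (\<lambda>x. cmod (f x) powr r) \<longleftrightarrow> integrable M (\<lambda>x. cmod (g x) powr r)" for r
    by (rule integrable_cong_AE[OF _ _ pow]) measurable
  have val: "(LINT x|M. cmod (f x) powr r) = (LINT x|M. cmod (g x) powr r)" for r
    by (rule integral_cong_AE[OF _ _ pow]) measurable
  show "f \<in> Lp p M \<longleftrightarrow> g \<in> Lp p M" by (simp add: Lp_def f g ess int)
  show "Lp_norm p M f = Lp_norm p M g" by (simp add: Lp_norm_def ess val)
  show "fourier_coeff M f \<gamma> = fourier_coeff M g \<gamma>" if "\<gamma> \<in> borel_measurable M"
  proof -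
    have [measurable]: "(\<lambda>x. cnj (\<gamma> x)) \<in> borel_measurable M"
      by (rule borel_measurable_continuous_on[OF _ that]) (intro continuous_intros)
    show ?thesis
      unfolding fourier_coeff_def by (rule integral_cong_AE) (use eq in auto)
  qed
qed

lemma Lp_distr:
  assumes \<Phi>: "\<Phi> \<in> measurable M X" and F: "F \<in> borel_measurable X"
  shows "F \<in> Lp p (distr M X \<Phi>) \<longleftrightarrow> (\<lambda>x. F (\<Phi> x)) \<in> Lp p M"
    and "Lp_norm p (distr M X \<Phi>) F = Lp_norm p M (\<lambda>x. F (\<Phi> x))"
proof -
  note [measurable] = \<Phi> F
  have ess: "esssup (distr M X \<Phi>) (\<lambda>y. ennreal (cmod (F y))) = esssup M (\<lambda>x. ennreal (cmod (F (\<Phi> x))))"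
    by (subst (1 2) esssup_eq_AE) (auto simp: AE_distr_iff)
  show "F \<in> Lp p (distr M X \<Phi>) \<longleftrightarrow> (\<lambda>x. F (\<Phi> x)) \<in> Lp p M"
    using F by (simp add: Lp_def ess integrable_distr_eq)
  show "Lp_norm p (distr M X \<Phi>) F = Lp_norm p M (\<lambda>x. F (\<Phi> x))"
    by (simp add: Lp_norm_def ess integral_distr)
qed

section \<open>The map of a Dirichlet group to the torus\<close>

definition torus_map :: "(nat \<Rightarrow> real) \<Rightarrow> (real \<Rightarrow> 'g::{topological_ab_group_add, t2_space}) \<Rightarrow> 'g \<Rightarrow> nat \<Rightarrow> complex" where
  "torus_map l \<beta> x = (\<lambda>n. char_at \<beta> (l n) x)"

locale lambda_dirichlet_haar = dirichlet_haar \<beta> m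
  for l :: "nat \<Rightarrow> real" and \<beta> :: "real \<Rightarrow> 'g::{topological_ab_group_add, t2_space}" and m :: "'g measure" +
  assumes lambda_characters: "\<And>n. \<exists>h\<in>characters. \<forall>t. h (\<beta> t) = exp (- \<i> * complex_of_real (l n * t))"
begin

abbreviation "\<Phi> \<equiv> torus_map l \<beta>"
abbreviation "\<mu> \<equiv> distr m borel \<Phi>"

lemma char_at_character: "char_at \<beta> (l n) \<in> characters"
  and char_at_curve: "char_at \<beta> (l n) (\<beta> t) = exp (- \<i> * complex_of_real (l n * t))"
proof -
  obtain h where h: "h \<in> characters" "\<And>t. h (\<beta> t) = exp (- \<i> * complex_of_real (l n * t))"
    using lambda_characters by blast
  have "char_at \<beta> (l n) = h" by (rule char_at_eqI[OF dirichlet h])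
  then show "char_at \<beta> (l n) \<in> characters" "char_at \<beta> (l n) (\<beta> t) = exp (- \<i> * complex_of_real (l n * t))"
    using h by auto
qed

lemma torus_map_curve: "\<Phi> (\<beta> t) = (\<lambda>n. exp (- \<i> * complex_of_real (l n * t)))"
  unfolding torus_map_def char_at_curve ..

lemma continuous_torus_map: "continuous_on UNIV \<Phi>"
  unfolding torus_map_def
  by (intro continuous_on_coordinatewise_then_product character_continuous char_at_character)

lemma measurable_torus_map [measurable]: "\<Phi> \<in> borel_measurable m"
  by (rule continuous_measurable[OF continuous_torus_map])

lemma torus_map_in_torus: "\<Phi> x \<in> infinite_torus"
  using char_at_character by (auto simp: torus_map_def infinite_torus_def characters_def)

lemma pushforward_torus: "sets \<mu> = sets borel" "finite_measure \<mu>" "AE z in \<mu>. z \<in> infinite_torus"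
proof -
  show "finite_measure \<mu>" by (rule finite_measure_distr[OF measurable_torus_map])
  have [measurable]: "infinite_torus \<in> sets borel"
    using compact_infinite_torus by (intro borel_closed compact_imp_closed)
  show "AE z in \<mu>. z \<in> infinite_torus"
    by (subst AE_distr_iff[OF measurable_torus_map]) (auto simp: torus_map_in_torus)
qed simp

lemma monomial_character:
  assumes "q \<in> torus_monomials" shows "(\<lambda>x. q (\<Phi> x)) \<in> characters"
  using assms
proof induction
  case one
  show ?case by (rule character_one)
next
  case (coord q n)
  have "(\<lambda>x. \<Phi> x n) \<in> characters" using char_at_character by (simp add: torus_map_def)
  then show ?case by (rule character_mult[OF _ coord.IH])
next
  case (cnj_coord q n)
  have "(\<lambda>x. \<Phi> x n) \<in> characters" using char_at_character by (simp add: torus_map_def)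
  then show ?case by (rule character_mult[OF character_cnj cnj_coord.IH])
qed

text \<open>
  Relations between monomial characters are decided on the dense curve, where the torus map depends on
  the frequency alone. This is what makes two Dirichlet groups comparable.
\<close>
lemma monomial_eq_iff_curve:
  assumes q: "q \<in> torus_monomials" and r: "r \<in> torus_monomials"
  shows "(\<lambda>x. q (\<Phi> x)) = (\<lambda>x. r (\<Phi> x)) \<longleftrightarrow>
    (\<forall>t. q (\<lambda>n. exp (- \<i> * complex_of_real (l n * t))) = r (\<lambda>n. exp (- \<i> * complex_of_real (l n * t))))"
proof
  assume "(\<lambda>x. q (\<Phi> x)) = (\<lambda>x. r (\<Phi> x))"
  then show "\<forall>t. q (\<lambda>n. exp (- \<i> * complex_of_real (l n * t))) = r (\<lambda>n. exp (- \<i> * complex_of_real (l n * t)))"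
    unfolding torus_map_curve[symmetric] by metis
next
  assume *: "\<forall>t. q (\<lambda>n. exp (- \<i> * complex_of_real (l n * t))) = r (\<lambda>n. exp (- \<i> * complex_of_real (l n * t)))"
  have "closed {x. q (\<Phi> x) = r (\<Phi> x)}"
    by (intro closed_Collect_eq character_continuous monomial_character q r)
  moreover have "range \<beta> \<subseteq> {x. q (\<Phi> x) = r (\<Phi> x)}"
    using * unfolding torus_map_curve[symmetric] by auto
  ultimately have "closure (range \<beta>) \<subseteq> {x. q (\<Phi> x) = r (\<Phi> x)}" by (rule closure_minimal[rotated])
  then show "(\<lambda>x. q (\<Phi> x)) = (\<lambda>x. r (\<Phi> x))" by (auto simp: dense_\<beta>)
qed

lemma monomial_measurable [measurable]: "q \<in> torus_monomials \<Longrightarrow> q \<in> borel_measurable borel"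
  by (rule borel_measurable_continuous_onI[OF torus_monomials_continuous])

lemma integrable_mult_character:
  "integrable m f \<Longrightarrow> \<gamma> \<in> characters \<Longrightarrow> integrable m (\<lambda>x. \<gamma> x * f x)"
  by (rule integrable_mult_continuous[OF _ sets_m compact_UNIV]) (auto intro: character_continuous)

lemma integral_monomial:
  assumes "q \<in> torus_monomials"
  shows "(LINT z|\<mu>. q z) =
    (if \<forall>t. q (\<lambda>n. exp (- \<i> * complex_of_real (l n * t))) = 1 then 1 else 0)"
proof -
  have "(LINT z|\<mu>. q z) = (LINT x|m. q (\<Phi> x))"
    by (rule integral_distr) (use assms in measurable)
  then show ?thesis
    using integral_character[OF monomial_character[OF assms]] monomial_eq_iff_curve[OF assms torus_monomials.one]
    by simp
qed

lemma fourier_coeff_monomial: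
  assumes F: "F \<in> borel_measurable borel" and q: "q \<in> torus_monomials"
  shows "fourier_coeff m (\<lambda>x. F (\<Phi> x)) (\<lambda>x. q (\<Phi> x)) = (LINT z|\<mu>. F z * cnj (q z))"
  unfolding fourier_coeff_def
  by (rule integral_distr[symmetric, OF measurable_torus_map])
    (intro borel_measurable_times F monomial_measurable torus_monomials_cnj q)

text \<open>
  Project the conjugate of \<open>\<gamma>\<close> to a function \<open>\<Gamma>\<close> on the torus. Its coefficients are integrals of
  the non-trivial characters \<open>(q \<circ> \<Phi>) \<cdot> cnj \<gamma>\<close> and vanish, so \<open>\<Gamma>\<close> is zero almost
  everywhere.
\<close>
lemma fourier_coeff_non_monomial:
  assumes F: "F \<in> borel_measurable borel" "integrable \<mu> F"
    and \<gamma>: "\<gamma> \<in> characters" "\<And>q. q \<in> torus_monomials \<Longrightarrow> \<gamma> \<noteq> (\<lambda>x. q (\<Phi> x))"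
  shows "fourier_coeff m (\<lambda>x. F (\<Phi> x)) \<gamma> = 0"
proof -
  have cnj\<gamma>: "(\<lambda>x. cnj (\<gamma> x)) \<in> characters" by (rule character_cnj[OF \<gamma>(1)])
  have int_cnj: "integrable m (\<lambda>x. cnj (\<gamma> x))"
    by (intro continuous_integrable character_continuous cnj\<gamma>)
  obtain \<Gamma> where \<Gamma>: "\<Gamma> \<in> borel_measurable borel" "integrable \<mu> \<Gamma>"
    and proj: "\<And>k. k \<in> borel_measurable borel \<Longrightarrow> integrable m (\<lambda>x. k (\<Phi> x) * cnj (\<gamma> x)) \<Longrightarrow>
       integrable \<mu> (\<lambda>y. k y * \<Gamma> y) \<and> (LINT y|\<mu>. k y * \<Gamma> y) = (LINT x|m. k (\<Phi> x) * cnj (\<gamma> x))"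
    using pushforward_density[OF finite_measure_axioms measurable_torus_map int_cnj] by blast
  have "AE z in \<mu>. \<Gamma> z = 0"
  proof (rule torus_monomial_coefficients_zero[OF pushforward_torus \<Gamma>(2)])
    fix q assume q: "q \<in> torus_monomials"
    have ch: "(\<lambda>x. q (\<Phi> x) * cnj (\<gamma> x)) \<in> characters"
      by (rule character_mult[OF monomial_character[OF q] cnj\<gamma>])
    have "(\<lambda>x. q (\<Phi> x) * cnj (\<gamma> x)) \<noteq> (\<lambda>x. 1)"
    proof
      assume eq: "(\<lambda>x. q (\<Phi> x) * cnj (\<gamma> x)) = (\<lambda>x. 1)"
      have "\<gamma> x = q (\<Phi> x)" for x
      proof -
        have "\<gamma> x * cnj (\<gamma> x) = 1"
          using \<gamma>(1) complex_norm_square[of "\<gamma> x"] by (simp add: characters_def)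
        moreover have "q (\<Phi> x) * cnj (\<gamma> x) = 1" using fun_cong[OF eq] .
        ultimately show ?thesis by (metis mult_cancel_right mult_zero_right zero_neq_one)
      qed
      then show False using \<gamma>(2)[OF q] by blast
    qed
    then have "(LINT x|m. q (\<Phi> x) * cnj (\<gamma> x)) = 0" using integral_character[OF ch] by simp
    moreover have "integrable m (\<lambda>x. q (\<Phi> x) * cnj (\<gamma> x))"
      by (intro continuous_integrable character_continuous ch)
    ultimately show "(LINT z|\<mu>. q z * \<Gamma> z) = 0"
      using proj[OF monomial_measurable[OF q]] by simp
  qed
  then have "AE z in \<mu>. F z * \<Gamma> z = 0" by eventually_elim simp
  then have "(LINT z|\<mu>. F z * \<Gamma> z) = 0" by (rule integral_eq_zero_AE)
  moreover have "integrable m (\<lambda>x. F (\<Phi> x) * cnj (\<gamma> x))"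
    using integrable_mult_character[OF _ cnj\<gamma>, of "\<lambda>x. F (\<Phi> x)"] F
      integrable_distr_eq[OF measurable_torus_map F(1)] by (simp add: mult.commute)
  ultimately show ?thesis using proj[OF F(1)] by (simp add: fourier_coeff_def)
qed

text \<open>
  The projection of \<open>f\<close> to the torus, pulled back, has the same Fourier coefficients as \<open>f\<close> at every
  character.
\<close>
lemma factor_through_torus:
  assumes f: "integrable m f"
    and spec: "\<And>\<gamma>. \<gamma> \<in> characters \<Longrightarrow> fourier_coeff m f \<gamma> \<noteq> 0 \<Longrightarrow> \<exists>q\<in>torus_monomials. \<gamma> = (\<lambda>x. q (\<Phi> x))"
  obtains F where "F \<in> borel_measurable borel" "integrable \<mu> F" "AE x in m. f x = F (\<Phi> x)"
proof -
  obtain F where F: "F \<in> borel_measurable borel" "integrable \<mu> F"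
    and proj: "\<And>k. k \<in> borel_measurable borel \<Longrightarrow> integrable m (\<lambda>x. k (\<Phi> x) * f x) \<Longrightarrow>
       integrable \<mu> (\<lambda>y. k y * F y) \<and> (LINT y|\<mu>. k y * F y) = (LINT x|m. k (\<Phi> x) * f x)"
    using pushforward_density[OF finite_measure_axioms measurable_torus_map f] by blast
  have F\<Phi>: "integrable m (\<lambda>x. F (\<Phi> x))"
    using integrable_distr_eq[OF measurable_torus_map F(1)] F(2) by simp
  have coeff_eq: "fourier_coeff m (\<lambda>x. F (\<Phi> x)) \<gamma> = fourier_coeff m f \<gamma>" if \<gamma>: "\<gamma> \<in> characters" for \<gamma>
  proof (cases "\<exists>q\<in>torus_monomials. \<gamma> = (\<lambda>x. q (\<Phi> x))")
    case True
    then obtain q where q: "q \<in> torus_monomials" "\<gamma> = (\<lambda>x. q (\<Phi> x))" by blast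
    have q': "(\<lambda>z. cnj (q z)) \<in> torus_monomials" by (rule torus_monomials_cnj[OF q(1)])
    have "integrable m (\<lambda>x. cnj (q (\<Phi> x)) * f x)"
      by (rule integrable_mult_character[OF f monomial_character[OF q']])
    then have "(LINT z|\<mu>. cnj (q z) * F z) = (LINT x|m. cnj (q (\<Phi> x)) * f x)"
      using proj[OF monomial_measurable[OF q']] by simp
    then show ?thesis unfolding q(2) fourier_coeff_monomial[OF F(1) q(1)]
      by (simp add: fourier_coeff_def mult.commute)
  next
    case False
    then have "fourier_coeff m f \<gamma> = 0" using spec[OF \<gamma>] by blast
    moreover have "fourier_coeff m (\<lambda>x. F (\<Phi> x)) \<gamma> = 0"
      using False by (intro fourier_coeff_non_monomial F \<gamma>) blast
    ultimately show ?thesis by simp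
  qed
  have "AE x in m. f x - F (\<Phi> x) = 0"
  proof (rule fourier_coeff_zero_imp_zero)
    show "integrable m (\<lambda>x. f x - F (\<Phi> x))" using f F\<Phi> by simp
    fix \<gamma> :: "'g \<Rightarrow> complex" assume \<gamma>: "\<gamma> \<in> characters"
    have i: "integrable m (\<lambda>x. h x * cnj (\<gamma> x))" if "integrable m h" for h
      using integrable_mult_character[OF that character_cnj[OF \<gamma>]] by (simp add: mult.commute)
    show "fourier_coeff m (\<lambda>x. f x - F (\<Phi> x)) \<gamma> = 0"
      using coeff_eq[OF \<gamma>] i[OF f] i[OF F\<Phi>]
      by (simp add: fourier_coeff_def left_diff_distrib)
  qed
  then have "AE x in m. f x = F (\<Phi> x)" by eventually_elim simp
  then show thesis by (rule that[OF F])
qed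

end

section \<open>Comparing two Dirichlet groups\<close>

lemma lambda_dirichlet_haarI:
  assumes "lambda_dirichlet_group l \<beta>" "normalized_haar m"
  shows "lambda_dirichlet_haar l \<beta> m"
  using assms by unfold_locales (auto simp: lambda_dirichlet_group_def)

text \<open>
  The moments of both measures are read off from the curve alone.
\<close>
lemma pushforward_torus_eq:
  assumes "lambda_dirichlet_haar l \<beta>G mG" and "lambda_dirichlet_haar l \<beta>H mH"
  shows "distr mG borel (torus_map l \<beta>G) = distr mH borel (torus_map l \<beta>H)"
proof -
  interpret G: lambda_dirichlet_haar l \<beta>G mG by fact
  interpret H: lambda_dirichlet_haar l \<beta>H mH by fact
  show ?thesis
    by (rule torus_measures_eqI[OF G.pushforward_torus H.pushforward_torus])
      (simp only: G.integral_monomial H.integral_monomial)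
qed

text \<open>
  Both functions are pullbacks of one function \<open>F\<close> on the torus, and the image of Haar measure on the
  torus is the same for both groups. Hence they have the same distribution, and the coefficients at
  corresponding monomial characters are given by the same integral over the torus.
\<close>
lemma hardy_function_transfer:
  assumes G: "lambda_dirichlet_haar l \<beta>G mG" and H: "lambda_dirichlet_haar l \<beta>H mH" and p: "1 \<le> p"
    and f: "f \<in> Hp_lambda l p \<beta>G mG"
  shows "\<exists>g\<in>Hp_lambda l p \<beta>H mH.
      (\<forall>n. fourier_coeff mH g (char_at \<beta>H (l n)) = fourier_coeff mG f (char_at \<beta>G (l n))) \<and>
      Lp_norm p mH g = Lp_norm p mG f"
proof -
  interpret G: lambda_dirichlet_haar l \<beta>G mG by fact
  interpret H: lambda_dirichlet_haar l \<beta>H mH by fact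
  note \<mu>_eq = pushforward_torus_eq[OF G H]
  define q where "q n = (\<lambda>z :: nat \<Rightarrow> complex. z n * 1)" for n :: nat
  have q: "q n \<in> torus_monomials" for n unfolding q_def by (intro torus_monomials.intros)
  have charG: "char_at \<beta>G (l n) = (\<lambda>x. q n (G.\<Phi> x))" and charH: "char_at \<beta>H (l n) = (\<lambda>x. q n (H.\<Phi> x))" for n
    by (simp_all add: q_def torus_map_def)
  have fLp: "f \<in> Lp p mG"
    and fspec: "\<And>\<gamma>. \<gamma> \<in> characters \<Longrightarrow> fourier_coeff mG f \<gamma> \<noteq> 0 \<Longrightarrow> \<exists>n. \<gamma> = char_at \<beta>G (l n)"
    using f by (auto simp: Hp_lambda_def)
  have fi: "integrable mG f" by (rule Lp_imp_integrable[OF G.finite_measure_axioms p fLp])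
  obtain F where F: "F \<in> borel_measurable borel" "integrable G.\<mu> F" and fF: "AE x in mG. f x = F (G.\<Phi> x)"
  proof (rule G.factor_through_torus[OF fi])
    show "\<exists>q\<in>torus_monomials. \<gamma> = (\<lambda>x. q (G.\<Phi> x))" if "\<gamma> \<in> characters" "fourier_coeff mG f \<gamma> \<noteq> 0" for \<gamma>
      using fspec[OF that] charG q by blast
  qed
  note [measurable] = F(1)
  define g where "g x = F (H.\<Phi> x)" for x
  have FGm: "(\<lambda>x. F (G.\<Phi> x)) \<in> borel_measurable mG" by measurable
  have coeffG: "fourier_coeff mG f (\<lambda>x. r (G.\<Phi> x)) = (LINT z|G.\<mu>. F z * cnj (r z))" if r: "r \<in> torus_monomials" for r
    using Lp_cong_AE(3)[OF borel_measurable_integrable[OF fi] FGm fF, of "\<lambda>x. r (G.\<Phi> x)"]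
      G.continuous_measurable[OF G.character_continuous[OF G.monomial_character[OF r]]]
      G.fourier_coeff_monomial[OF F(1) r] by simp
  have coeffH: "fourier_coeff mH g (\<lambda>x. r (H.\<Phi> x)) = fourier_coeff mG f (\<lambda>x. r (G.\<Phi> x))" if r: "r \<in> torus_monomials" for r
    unfolding g_def H.fourier_coeff_monomial[OF F(1) r] coeffG[OF r] \<mu>_eq ..
  have "g \<in> Lp p mH"
    using fLp Lp_cong_AE(1)[OF borel_measurable_integrable[OF fi] FGm fF, of p]
      Lp_distr(1)[OF G.measurable_torus_map F(1), of p] Lp_distr(1)[OF H.measurable_torus_map F(1), of p]
    unfolding g_def \<mu>_eq by simp
  moreover have "Lp_norm p mH g = Lp_norm p mG f"
    using Lp_cong_AE(2)[OF borel_measurable_integrable[OF fi] FGm fF, of p]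
      Lp_distr(2)[OF G.measurable_torus_map F(1), of p] Lp_distr(2)[OF H.measurable_torus_map F(1), of p]
    unfolding g_def \<mu>_eq by simp
  moreover have "\<exists>n. \<gamma> = char_at \<beta>H (l n)" if \<gamma>: "\<gamma> \<in> characters" "fourier_coeff mH g \<gamma> \<noteq> 0" for \<gamma>
  proof -
    obtain r where r: "r \<in> torus_monomials" "\<gamma> = (\<lambda>x. r (H.\<Phi> x))"
      using H.fourier_coeff_non_monomial[OF F(1) _ \<gamma>(1)] F(2) \<gamma>(2) unfolding g_def \<mu>_eq by blast
    have "fourier_coeff mG f (\<lambda>x. r (G.\<Phi> x)) \<noteq> 0" using \<gamma>(2) coeffH[OF r(1)] r(2) by simp
    then obtain n where "(\<lambda>x. r (G.\<Phi> x)) = char_at \<beta>G (l n)"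
      using fspec[OF G.monomial_character[OF r(1)]] by blast
    then have "(\<lambda>x. r (H.\<Phi> x)) = char_at \<beta>H (l n)"
      unfolding charG charH G.monomial_eq_iff_curve[OF r(1) q] H.monomial_eq_iff_curve[OF r(1) q] .
    then show ?thesis using r(2) by blast
  qed
  ultimately show ?thesis
    using coeffH[OF q] by (intro bexI[of _ g]) (auto simp: Hp_lambda_def charG charH)
qed

theorem theorem3p24:
  fixes l :: "nat \<Rightarrow> real" and p :: ennreal
    and \<beta>G :: "real \<Rightarrow> 'g::{topological_ab_group_add, t2_space}" and mG :: "'g measure"
    and \<beta>H :: "real \<Rightarrow> 'h::{topological_ab_group_add, t2_space}" and mH :: "'h measure"
  assumes "frequency l" and "1 \<le> p"
    and "lambda_dirichlet_group l \<beta>G" and "normalized_haar mG"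
    and "lambda_dirichlet_group l \<beta>H" and "normalized_haar mH"
  shows "hardy_space l p \<beta>G mG = hardy_space l p \<beta>H mH \<and>
         (\<forall>D \<in> hardy_space l p \<beta>G mG. hardy_norm l p \<beta>G mG D = hardy_norm l p \<beta>H mH D)"
proof -
  note G = lambda_dirichlet_haarI[OF assms(3,4)] and H = lambda_dirichlet_haarI[OF assms(5,6)]
  \<comment> \<open>Both the space and its norm are defined by this relation between a coefficient sequence and a number, so the norms agree as soon as the relations do.\<close>
  have GH: "(\<exists>f \<in> Hp_lambda l p \<beta>G mG. (\<forall>n. fourier_coeff mG f (char_at \<beta>G (l n)) = D n) \<and> r = Lp_norm p mG f) \<longleftrightarrow>
      (\<exists>g \<in> Hp_lambda l p \<beta>H mH. (\<forall>n. fourier_coeff mH g (char_at \<beta>H (l n)) = D n) \<and> r = Lp_norm p mH g)" for D r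
    using hardy_function_transfer[OF G H assms(2)] hardy_function_transfer[OF H G assms(2)] by metis
  have "hardy_space l p \<beta>G mG = hardy_space l p \<beta>H mH"
    unfolding hardy_space_def using GH by blast
  moreover have "hardy_norm l p \<beta>G mG D = hardy_norm l p \<beta>H mH D" for D
    unfolding hardy_norm_def GH ..
  ultimately show ?thesis by blast
qed

end
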